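(* Let $T>0$. There exists a constant $C>0$, independent of $N$, such that for every $N\in\mathbb{N}$ with $T>4(2+N^{-1})$ and every final data $(\phi^{0,N},\phi^{1,N})\in\mathbb{P}^{Di}_N(\Omega)\times\mathbb{P}^{Di}_N(\Omega)$, the solution $\phi^N$, with $\phi^N(t,\cdot)\in\mathbb{P}_N^{Di}(\Omega)$, of $$\begin{cases} (\phi^{N}_{tt}-\phi^{N}_{xx})(t,x_{i})=0, & t\in(0,T),\ x_i\in C^{\Omega},\\ \phi^{N}(t,1)=\phi^{N}(t,-1)=0, & t\in (0,T),\\ \phi^{N}(T,x_{i})=\phi^{0,N}(x_i),\quad \phi_{t}^{N}(T,x_{i})=\phi^{1,N}(x_i), & x_{i}\in C^{\Omega}, \end{cases}$$ satisfies $$C\left\|(\phi^{0,N}_x,\phi^{1,N}) \right\|^{2}_{N\times N}\le \int_{0}^{T}\left| \phi^{N}_{x}(t,1)-\omega_{N}\phi^{N}_{xx}(t,1)\right|^{2} dt+\omega_{N}\int_{0}^{T}\left| \phi^{N}_{xx}(t,1)\right|^{2} dt+\omega_{0}\int_{0}^{T}\left| \phi^{N}_{xx}(t,-1)\right|^{2} dt .$$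
   Context: $\Omega=(-1,1)$. $\mathbb{P}_N(\Omega)$ is the space of polynomials on $\bar\Omega$ of degree at most $N$, and $\mathbb{P}_N^{Di}(\Omega)$ is its subspace of polynomials vanishing at $x=\pm1$. The Legendre-Gauss-Lobatto (LGL) nodes $-1=x_0<x_1<\dots<x_N=1$ are the roots of $(1-x^2)L_N'(x)$, where $L_N$ is the $N$-th Legendre polynomial; $C^\Omega=\{x_1,\dots,x_{N-1}\}$ is the set of interior nodes. $\omega_i$, $0\le i\le N$, are the LGL quadrature weights, so that $\sum_{i=0}^N p(x_i)\omega_i=\int_{-1}^1p\,dx$ for all polynomials $p$ of degree at most $2N-1$; in particular $\omega_0=\omega_N=\frac{2}{N(N+1)}$. The discrete inner product and norm are $(w,z)_N=\sum_{i=0}^N w(x_i)z(x_i)\omega_i$, $\|z\|_N^2=(z,z)_N$, and $\|(v,w)\|_{N\times N}^2=\|v\|_N^2+\|w\|_N^2$. *)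

theory Defs
  imports "HOL-Analysis.Analysis" "HOL-Computational_Algebra.Polynomial"
begin

(* Rodrigues' formula: L_n = 1 / (2^n n!) * (d/dx)^n (x^2 - 1)^n. *)
definition legendre :: "nat \<Rightarrow> real poly" where
  "legendre n = smult (1 / (2 ^ n * fact n)) ((pderiv ^^ n) ([:-1, 0, 1:] ^ n))"

definition poly_space :: "nat \<Rightarrow> real poly set" where
  "poly_space N = {p. degree p \<le> N}"

definition poly_space_Di :: "nat \<Rightarrow> real poly set" where
  "poly_space_Di N = {p \<in> poly_space N. poly p 1 = 0 \<and> poly p (-1) = 0}"

(* For N \<ge> 1 the root set has exactly N + 1 elements, so lgl_node N i is
   meaningful for i \<le> N; the interior nodes are those with 1 \<le> i < N. *)
definition lgl_node :: "nat \<Rightarrow> nat \<Rightarrow> real" where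
  "lgl_node N i = sorted_list_of_set {x. (1 - x\<^sup>2) * poly (pderiv (legendre N)) x = 0} ! i"

(* For N \<ge> 1 weights with this exactness property exist, and since the nodes are
   distinct and N \<le> 2 * N - 1 their values at i \<le> N are uniquely determined. *)
definition lgl_weight :: "nat \<Rightarrow> nat \<Rightarrow> real" where
  "lgl_weight N = (SOME w. \<forall>p :: real poly. degree p \<le> 2 * N - 1 \<longrightarrow>
     (\<Sum>i\<le>N. poly p (lgl_node N i) * w i) = integral {-1..1} (\<lambda>x. poly p x))"

definition discrete_inner :: "nat \<Rightarrow> (real \<Rightarrow> real) \<Rightarrow> (real \<Rightarrow> real) \<Rightarrow> real" where
  "discrete_inner N w z = (\<Sum>i\<le>N. w (lgl_node N i) * z (lgl_node N i) * lgl_weight N i)"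

definition discrete_norm :: "nat \<Rightarrow> (real \<Rightarrow> real) \<Rightarrow> real" where
  "discrete_norm N z = sqrt (discrete_inner N z z)"

definition discrete_pair_norm :: "nat \<Rightarrow> (real \<Rightarrow> real) \<Rightarrow> (real \<Rightarrow> real) \<Rightarrow> real" where
  "discrete_pair_norm N v w = sqrt ((discrete_norm N v)\<^sup>2 + (discrete_norm N w)\<^sup>2)"

(* phit and phitt are the first and second time derivatives of (t, x) \<mapsto> poly (phi t) x.
   The solution is of class C^1 in time on [0, T] (one-sided derivatives at the ends,
   so that the final velocity makes sense) and twice differentiable on (0, T). *)
definition collocation_solution ::
  "real \<Rightarrow> nat \<Rightarrow> real poly \<Rightarrow> real poly \<Rightarrow> (real \<Rightarrow> real poly) \<Rightarrow> bool" where
  "collocation_solution T N phi0 phi1 phi \<longleftrightarrow>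
     (\<forall>t\<in>{0..T}. phi t \<in> poly_space_Di N) \<and>
     (\<exists>phit phitt :: real \<Rightarrow> real \<Rightarrow> real.
        (\<forall>x\<in>{-1..1}.
           (\<forall>t\<in>{0..T}. ((\<lambda>s. poly (phi s) x) has_real_derivative phit t x) (at t within {0..T})) \<and>
           continuous_on {0..T} (\<lambda>t. phit t x) \<and>
           (\<forall>t\<in>{0<..<T}. ((\<lambda>s. phit s x) has_real_derivative phitt t x) (at t))) \<and>
        (\<forall>t\<in>{0<..<T}. \<forall>i\<in>{1..<N}.
           phitt t (lgl_node N i) - poly (pderiv (pderiv (phi t))) (lgl_node N i) = 0) \<and>
        (\<forall>t\<in>{0<..<T}. poly (phi t) 1 = 0 \<and> poly (phi t) (-1) = 0) \<and>
        (\<forall>i\<in>{1..<N}.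
           poly (phi T) (lgl_node N i) = poly phi0 (lgl_node N i) \<and>
           phit T (lgl_node N i) = poly phi1 (lgl_node N i)))"

end

theory Submission
  imports Defs
begin

text \<open>
  Let \<open>\<psi> = \<phi>\<^sub>t\<close>, and let \<open>b\<close> be the coefficient of \<open>L\<^sub>N\<close> in \<open>\<phi>\<close>. The energy
  \<open>E = (\<parallel>\<phi>\<^sub>x\<parallel>\<^sub>N\<^sup>2 + \<parallel>\<psi>\<parallel>\<^sub>N\<^sup>2) / 2\<close> is conserved. The multiplier \<open>(1 + x) \<phi>\<^sub>x\<close> gives
  the square \<open>(\<phi>\<^sub>x - \<omega>\<^sub>N \<phi>\<^sub>x\<^sub>x)\<^sup>2\<close> at \<open>x = 1\<close>, but the quadrature is not exact on
  \<open>\<psi> (1 + x) \<psi>\<^sub>x\<close>, which leaves a term \<open>(1 + 1/N) b'\<^sup>2\<close> of the wrong sign. Testing the equation with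
  \<open>L\<^sub>N\<close> shows \<open>(N + 1) b'' = - (\<phi>\<^sub>x\<^sub>x(1) + L\<^sub>N(-1) \<phi>\<^sub>x\<^sub>x(-1))\<close>, so writing \<open>b'\<^sup>2 = (b b')' - b b''\<close>
  turns that term into a time-boundary term and products of \<open>b\<close> with the observed \<open>\<phi>\<^sub>x\<^sub>x(\<plusminus>1)\<close>.
  Since \<open>N b\<^sup>2 \<le> \<parallel>\<phi>\<^sub>x\<parallel>\<^sub>N\<^sup>2\<close> and \<open>(2/N) b'\<^sup>2 \<le> \<parallel>\<psi>\<parallel>\<^sub>N\<^sup>2\<close>, both are absorbed once \<open>T > 8\<close>, and the
  constant is absolute.
\<close>

text \<open>Products such as \<open>[:1, 1:] * p\<close> have to stay products, since integration by
  parts and degree bounds are applied to them.\<close>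

declare mult_pCons_left [simp del] mult_pCons_right [simp del]

section \<open>Integration of polynomials\<close>

definition pint :: "real poly \<Rightarrow> real" where
  "pint p = integral {-1..1} (poly p)"

lemma poly_integrable [simp]: "poly (p :: real poly) integrable_on {a..b}"
  by (intro integrable_continuous_interval continuous_intros)

lemma pint_0 [simp]: "pint 0 = 0"
  by (simp add: pint_def poly_0[abs_def])

lemma pint_add: "pint (p + q) = pint p + pint q"
  by (simp add: pint_def poly_add[abs_def] integral_add)

lemma pint_smult: "pint (smult c p) = c * pint p"
  by (simp add: pint_def poly_smult[abs_def])

lemma pint_minus: "pint (- p) = - pint p"
  using pint_smult[of "-1" p] by simp

lemma pint_diff: "pint (p - q) = pint p - pint q"
  using pint_add[of p "- q"] by (simp add: pint_minus)

lemma pint_sum: "pint (\<Sum>i\<in>A. f i) = (\<Sum>i\<in>A. pint (f i))"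
  by (induction A rule: infinite_finite_induct) (auto simp: pint_add)

lemma pint_pderiv: "pint (pderiv p) = poly p 1 - poly p (-1)"
proof -
  have "(poly (pderiv p) has_integral poly p 1 - poly p (-1)) {-1..1}"
    by (rule fundamental_theorem_of_calculus)
       (auto simp flip: has_real_derivative_iff_has_vector_derivative
             intro: has_field_derivative_at_within poly_DERIV)
  then show ?thesis
    by (simp add: pint_def integral_unique)
qed

lemma pint_parts:
  "pint (pderiv p * q) = poly p 1 * poly q 1 - poly p (-1) * poly q (-1) - pint (p * pderiv q)"
  using pint_pderiv[of "p * q"] by (simp add: pderiv_mult pint_add algebra_simps)

lemma pint_nonneg: "(\<And>x. x \<in> {-1..1} \<Longrightarrow> poly p x \<ge> 0) \<Longrightarrow> pint p \<ge> 0"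
  unfolding pint_def by (rule integral_nonneg) auto

text \<open>A continuous nonnegative integrand with zero integral vanishes on the whole interval,
  and only the zero polynomial has infinitely many roots.\<close>

lemma pint_eq_0D:
  assumes "\<And>x. x \<in> {-1..1} \<Longrightarrow> poly p x \<ge> 0" "pint p = 0"
  shows "p = 0"
proof (rule ccontr)
  assume "p \<noteq> 0"
  then have "finite {x. poly p x = 0}"
    by (rule poly_roots_finite)
  moreover have "{-1..1} \<subseteq> {x. poly p x = 0}"
    using integral_eq_0_iff[of "-1" 1 "poly p"] continuous_on_poly[OF continuous_on_id, of "{-1..1}" p] assms
    by (auto simp: pint_def)
  ultimately have "finite {-1..1::real}"
    using finite_subset by blast
  then show False
    using infinite_Icc[of "-1" "1 :: real"] by simp
qed

lemma pint_square_eq_0D: "pint (p * p) = 0 \<Longrightarrow> p = 0"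
  using pint_eq_0D[of "p * p"] by simp

section \<open>Degree bounds\<close>

lemma degree_mult_leI:
  fixes p q :: "'a :: comm_semiring_0 poly"
  shows "degree p \<le> a \<Longrightarrow> degree q \<le> b \<Longrightarrow> a + b \<le> c \<Longrightarrow> degree (p * q) \<le> c"
  using degree_mult_le[of p q] by linarith

lemma degree_less_of_coeff:
  "degree p \<le> N \<Longrightarrow> coeff p N = 0 \<Longrightarrow> 0 < N \<Longrightarrow> degree p < N"
  by (metis leading_coeff_0_iff degree_0 le_neq_implies_less)

text \<open>The operator \<open>x d/dx\<close> multiplies the coefficient of \<open>x^N\<close> by
  \<open>N\<close>, so the top terms cancel. This trades \<open>x p'\<close> for \<open>N p\<close>
  up to a remainder that orthogonality or exactness can handle.\<close>

lemma degree_euler_less: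
  fixes p :: "real poly"
  assumes "degree p \<le> N" "0 < N"
  shows "degree ([:0, 1:] * pderiv p - smult (real N) p) < N"
proof (rule degree_less_of_coeff)
  have "degree ([:0, 1:] * pderiv p) \<le> N"
    using assms by (intro degree_mult_leI[of _ 1 _ "N - 1"]) (auto simp: degree_pderiv)
  then show "degree ([:0, 1:] * pderiv p - smult (real N) p) \<le> N"
    using assms by (intro degree_diff_le) (auto intro: order.trans[OF degree_smult_le])
  show "coeff ([:0, 1:] * pderiv p - smult (real N) p) N = 0"
    using assms by (cases N) (auto simp: coeff_pderiv mult_pCons_left)
qed (use assms in auto)

section \<open>Sign changes\<close>

lemma poly_no_root_sign:
  fixes Q :: "real poly"
  assumes "\<And>x. x \<in> {-1<..<1} \<Longrightarrow> poly Q x \<noteq> 0"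
  shows "(\<forall>x\<in>{-1..1}. poly Q x \<ge> 0) \<or> (\<forall>x\<in>{-1..1}. poly Q x \<le> 0)"
proof (rule ccontr)
  assume "\<not> ?thesis"
  then obtain x y where xy: "x \<in> {-1..1}" "y \<in> {-1..1}" "poly Q x < 0" "poly Q y > 0"
    by (auto simp: not_le)
  then have "x < y \<or> y < x"
    by (metis less_asym linorder_neqE_linordered_idom)
  then obtain z where "z \<in> {-1<..<1}" "poly Q z = 0"
    using xy poly_IVT_pos[of x y Q] poly_IVT_neg[of y x Q] by force
  with assms show False by blast
qed

text \<open>\<open>A\<close> collects the interior roots of odd multiplicity; one more linear factor
  for each makes all interior multiplicities even. The induction splits off one root at a
  time.\<close>

lemma sign_change_set:
  fixes Q :: "real poly"
  assumes "Q \<noteq> 0"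
  shows "\<exists>A. finite A \<and> A \<subseteq> {-1<..<1} \<and> (\<forall>z\<in>A. poly Q z = 0) \<and>
    ((\<forall>x\<in>{-1..1}. poly (Q * (\<Prod>z\<in>A. [:-z, 1:])) x \<ge> 0) \<or>
     (\<forall>x\<in>{-1..1}. poly (Q * (\<Prod>z\<in>A. [:-z, 1:])) x \<le> 0))"
  using assms
proof (induction "degree Q" arbitrary: Q rule: less_induct)
  case less
  show ?case
  proof (cases "\<exists>z\<in>{-1<..<1}. poly Q z = 0")
    case False
    with poly_no_root_sign[of Q] show ?thesis
      by (intro exI[of _ "{}"]) auto
  next
    case True
    then obtain z Q1 where z: "z \<in> {-1<..<1}" and Q: "Q = [:-z, 1:] * Q1"
      by (auto simp: poly_eq_0_iff_dvd dvd_def)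
    with less.prems have "Q1 \<noteq> 0" by auto
    then have "degree Q1 < degree Q"
      unfolding Q by (subst degree_mult_eq) auto
    from less.hyps[OF this \<open>Q1 \<noteq> 0\<close>] obtain A where A: "finite A" "A \<subseteq> {-1<..<1}"
      "\<forall>z\<in>A. poly Q1 z = 0" and sgn:
      "(\<forall>x\<in>{-1..1}. poly (Q1 * (\<Prod>z\<in>A. [:-z, 1:])) x \<ge> 0) \<or>
       (\<forall>x\<in>{-1..1}. poly (Q1 * (\<Prod>z\<in>A. [:-z, 1:])) x \<le> 0)"
      by blast
    show ?thesis
    \<comment> \<open>Splitting off \<open>z\<close> flips the parity of its multiplicity: it leaves
      \<open>A\<close> if present, and otherwise joins \<open>A\<close>, which produces the harmless
      factor \<open>(x - z)^2\<close>.\<close>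
    proof (cases "z \<in> A")
      case True
      have "Q * (\<Prod>z\<in>A - {z}. [:-z, 1:]) = Q1 * (\<Prod>z\<in>A. [:-z, 1:])"
        using prod.remove[OF A(1) True, of "\<lambda>z. [:-z, 1:]"] by (simp add: Q mult_ac)
      moreover have "\<forall>y\<in>A - {z}. poly Q y = 0"
        using A(3) by (simp add: Q)
      ultimately show ?thesis
        using A(1,2) sgn by (intro exI[of _ "A - {z}"]) (auto simp del: poly_mult)
    next
      case False
      have "poly (Q * (\<Prod>z\<in>insert z A. [:-z, 1:])) x
          = (x - z)\<^sup>2 * poly (Q1 * (\<Prod>z\<in>A. [:-z, 1:])) x" for x
        using A(1) False by (simp add: Q power2_eq_square algebra_simps)
      moreover have "\<forall>y\<in>insert z A. poly Q y = 0"
        using A(3) by (simp add: Q)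
      ultimately show ?thesis
        using A(1,2) sgn z
        by (intro exI[of _ "insert z A"])
           (auto simp: mult_nonneg_nonneg mult_nonneg_nonpos simp del: poly_mult)
    qed
  qed
qed

section \<open>Legendre polynomials\<close>

lemma power_dvd_pderiv:
  fixes r p :: "real poly"
  assumes "r ^ Suc m dvd p"
  shows "r ^ m dvd pderiv p"
proof -
  from assms obtain s where "p = r ^ Suc m * s" by (auto simp: dvd_def)
  then have "pderiv p = r ^ m * (r * pderiv s + smult (of_nat (Suc m)) (pderiv r) * s)"
    by (simp only: pderiv_mult pderiv_power_Suc) (simp add: algebra_simps)
  then show ?thesis by simp
qed

lemma power_dvd_pderiv_funpow:
  fixes r :: "real poly"
  shows "j \<le> n \<Longrightarrow> r ^ (n - j) dvd (pderiv ^^ j) (r ^ n)"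
proof (induction j)
  case (Suc j)
  then have "r ^ Suc (n - Suc j) dvd (pderiv ^^ j) (r ^ n)"
    by (simp add: Suc_diff_Suc)
  from power_dvd_pderiv[OF this] show ?case by simp
qed simp

text \<open>Integrate by parts \<open>k\<close> times: every derivative of
  \<open>(x^2 - 1)^n\<close> of order below \<open>n\<close> keeps a factor \<open>x^2 - 1\<close>,
  so no boundary terms arise, while \<open>q\<close> is differentiated to zero.\<close>

lemma rodrigues_orthogonal:
  assumes "k \<le> n" "degree q < k"
  shows "pint ((pderiv ^^ k) ([:-1, 0, 1:] ^ n) * q) = 0"
  using assms
proof (induction k arbitrary: q)
  case (Suc k)
  let ?u = "(pderiv ^^ k) ([:-1, 0, 1:] ^ n) :: real poly"
  have "[:-1, 0, 1 :: real:] dvd [:-1, 0, 1:] ^ (n - k)"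
    using Suc.prems by (intro dvd_power) auto
  also have "\<dots> dvd ?u"
    using Suc.prems by (intro power_dvd_pderiv_funpow) auto
  finally have "poly ?u 1 = 0" "poly ?u (-1) = 0"
    by (auto simp: dvd_def)
  then have "pint (pderiv ?u * q) = - pint (?u * pderiv q)"
    using pint_parts[of ?u q] by simp
  also have "pint (?u * pderiv q) = 0"
  proof (cases "degree q = 0")
    case True
    then have "pderiv q = 0" by (simp add: pderiv_eq_0_iff)
    then show ?thesis by simp
  next
    case False
    then show ?thesis
      using Suc by (intro Suc.IH) (auto simp: degree_pderiv)
  qed
  finally show ?case by simp
qed simp

lemma legendre_orthogonal: "degree q < n \<Longrightarrow> pint (legendre n * q) = 0"
  using rodrigues_orthogonal[of n n q] by (simp add: legendre_def pint_smult)

lemma degree_legendre [simp]: "degree (legendre n) = n"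
  by (simp add: legendre_def degree_higher_pderiv degree_power_eq)

text \<open>Degree and orthogonality determine the Legendre polynomial up to a nonzero factor, so
  the normalisation \<open>poly P 1 = 1\<close> can be imposed later by scaling.\<close>

locale orthogonal_poly =
  fixes N :: nat and P :: "real poly"
  assumes N_pos: "0 < N" and degree_P: "degree P = N"
    and orth: "\<And>q. degree q < N \<Longrightarrow> pint (P * q) = 0"
begin

abbreviation "W \<equiv> [:1, 0, -1 :: real:]"

lemma lead_nz: "coeff P N \<noteq> 0"
  using degree_P N_pos leading_coeff_0_iff[of P] by auto

lemma P_nz: "P \<noteq> 0"
  using lead_nz by auto

lemma pint_PP_pos: "pint (P * P) > 0"
  using pint_square_eq_0D[of P] pint_nonneg[of "P * P"] P_nz by fastforce

text \<open>Integrating \<open>P' P\<close> by parts shows that both squares agree, as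
  \<open>P'\<close> is orthogonal to \<open>P\<close>. Integrating \<open>x P' P\<close> by parts
  gives their sum, since \<open>x P'\<close> equals \<open>N P\<close> plus lower terms.\<close>

lemma endpoint_square:
  shows "(poly P 1)\<^sup>2 = (real N + 1/2) * pint (P * P)"
    and "(poly P (-1))\<^sup>2 = (real N + 1/2) * pint (P * P)"
proof -
  have "pint (pderiv P * P) = 0"
    using orth[of "pderiv P"] N_pos by (simp add: degree_pderiv degree_P mult.commute)
  then have eq: "(poly P 1)\<^sup>2 = (poly P (-1))\<^sup>2"
    using pint_parts[of P P] by (simp add: power2_eq_square mult.commute)
  have "pint (P * ([:0, 1:] * pderiv P)) = real N * pint (P * P)"
    using orth[OF degree_euler_less[of P N]] N_pos degree_P
    by (simp add: right_diff_distrib pint_diff pint_smult)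
  moreover have "pint (pderiv P * ([:0, 1:] * P)) = (poly P 1)\<^sup>2 + (poly P (-1))\<^sup>2
      - pint (P * P) - pint (P * ([:0, 1:] * pderiv P))"
    by (subst pint_parts) (simp add: pderiv_mult pderiv_pCons pint_add power2_eq_square algebra_simps flip: one_pCons)
  moreover have "pderiv P * ([:0, 1:] * P) = P * ([:0, 1:] * pderiv P)"
    by (simp add: algebra_simps)
  ultimately have "2 * real N * pint (P * P) = (poly P 1)\<^sup>2 + (poly P (-1))\<^sup>2 - pint (P * P)"
    by (simp add: mult_ac)
  with eq show "(poly P 1)\<^sup>2 = (real N + 1/2) * pint (P * P)"
    and "(poly P (-1))\<^sup>2 = (real N + 1/2) * pint (P * P)"
    by (simp_all add: algebra_simps)
qed

lemma pint_W_parts: "pint (W * pderiv p * q) = - pint (p * pderiv (W * q))"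
  using pint_parts[of p "W * q"] by (simp add: mult_ac)

text \<open>The top coefficients cancel in \<open>D\<close>, so its degree is below
  \<open>N\<close>. The operator \<open>(W p')'\<close> is symmetric and does not raise degrees, so
  \<open>D\<close> is orthogonal to all polynomials of degree below \<open>N\<close>, in particular
  to itself.\<close>

lemma legendre_ode: "pderiv (W * pderiv P) = - smult (real N * (real N + 1)) P"
proof -
  define D where "D = pderiv (W * pderiv P) + smult (real N * (real N + 1)) P"
  have W: "W * pderiv P = pderiv P - pCons 0 (pCons 0 (pderiv P))"
    by (simp add: mult_pCons_left)
  have dW: "degree (W * pderiv P) \<le> N + 1"
    using N_pos by (intro degree_mult_leI[of _ 2 _ "N - 1"]) (auto simp: degree_pderiv degree_P)
  have "degree D < N"
  proof (rule degree_less_of_coeff)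
    show "degree D \<le> N"
      unfolding D_def using dW degree_P
      by (intro degree_add_le) (auto simp: degree_pderiv)
    have "coeff (W * pderiv P) (Suc N) = - real N * coeff P N"
    proof (cases N)
      case (Suc M)
      have "coeff P (Suc (Suc (Suc M))) = 0"
        using degree_P Suc by (intro coeff_eq_0) auto
      then show ?thesis unfolding W by (simp add: Suc coeff_pderiv algebra_simps)
    qed (use N_pos in auto)
    then show "coeff D N = 0"
      unfolding D_def by (simp add: coeff_pderiv algebra_simps)
  qed (rule N_pos)
  have "pint (D * q) = 0" if q: "degree q < N" for q
  proof -
    have "degree (pderiv (W * pderiv q)) < N"
    proof -
      have "degree (W * pderiv q) \<le> N"
      proof (cases "degree q = 0")
        case True
        then have "pderiv q = 0" by (simp add: pderiv_eq_0_iff)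
        then show ?thesis by simp
      next
        case False
        with q show ?thesis
          by (intro degree_mult_leI[of _ 2 _ "N - 2"]) (auto simp: degree_pderiv)
      qed
      then show ?thesis
        using N_pos by (simp add: degree_pderiv)
    qed
    from orth[OF this] have "pint (W * pderiv P * pderiv q) = 0"
      by (simp add: pint_W_parts)
    then have "pint (pderiv (W * pderiv P) * q) = 0"
      using pint_parts[of "W * pderiv P" q] by simp
    then show ?thesis
      using orth[OF q] by (simp add: D_def distrib_right pint_add pint_smult)
  qed
  from this[OF \<open>degree D < N\<close>] have "D = 0" by (rule pint_square_eq_0D)
  then show ?thesis
    unfolding D_def by (simp add: eq_neg_iff_add_eq_0)
qed

text \<open>At the endpoints the second-order term of Legendre's equation drops out.\<close>

lemma pderiv_endpoints:
  shows "poly (pderiv P) 1 = real N * (real N + 1) / 2 * poly P 1"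
    and "poly (pderiv P) (-1) = - (real N * (real N + 1) / 2 * poly P (-1))"
proof -
  have *: "poly (pderiv (W * pderiv P)) x = - 2 * x * poly (pderiv P) x + (1 - x\<^sup>2) * poly (pderiv (pderiv P)) x" for x
    by (simp only: pderiv_mult) (simp add: pderiv_pCons power2_eq_square algebra_simps)
  show "poly (pderiv P) 1 = real N * (real N + 1) / 2 * poly P 1"
    using *[of 1] unfolding legendre_ode by (simp add: field_simps)
  show "poly (pderiv P) (-1) = - (real N * (real N + 1) / 2 * poly P (-1))"
    using *[of "-1"] unfolding legendre_ode by (simp add: field_simps)
qed

lemma pint_W_pderiv_P: "pint (W * pderiv P * pderiv p) = real N * (real N + 1) * pint (P * p)"
proof -
  have "pint (W * pderiv P * pderiv p) = - pint (pderiv (W * pderiv P) * p)"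
    using pint_parts[of "W * pderiv P" p] by simp
  then show ?thesis
    by (simp add: legendre_ode pint_minus pint_smult)
qed

text \<open>\<open>W\<close> vanishes at both endpoints, so integration by parts moves the
  derivative onto \<open>W * q\<close>, and \<open>P\<close> is orthogonal to the result.\<close>

lemma pderiv_orthogonal:
  assumes "degree q < N - 1"
  shows "pint (W * pderiv P * q) = 0"
proof -
  have "degree (W * q) \<le> N"
    using assms by (intro degree_mult_leI[of _ 2 _ "N - 2"]) auto
  then have "degree (pderiv (W * q)) < N"
    using N_pos by (simp add: degree_pderiv)
  from orth[OF this] show ?thesis
    by (simp add: pint_W_parts)
qed

lemma pderiv_P_nz: "pderiv P \<noteq> 0"
  using N_pos degree_P by (simp add: pderiv_eq_0_iff)

text \<open>With fewer than \<open>N - 1\<close> sign changes, the product \<open>q\<close> of their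
  linear factors would make \<open>W * pderiv P * q\<close> of one sign with zero integral. So there
  are at least \<open>N - 1\<close> sign changes, and the degree admits no further root.\<close>

lemma roots_pderiv:
  shows "card {x. poly (pderiv P) x = 0} = N - 1" and "{x. poly (pderiv P) x = 0} \<subseteq> {-1<..<1}"
proof -
  let ?R = "{x. poly (pderiv P) x = 0}"
  obtain A where A: "finite A" "A \<subseteq> {-1<..<1}" "\<forall>z\<in>A. poly (pderiv P) z = 0" and sgn:
      "(\<forall>x\<in>{-1..1}. poly (pderiv P * (\<Prod>z\<in>A. [:-z, 1:])) x \<ge> 0) \<or>
       (\<forall>x\<in>{-1..1}. poly (pderiv P * (\<Prod>z\<in>A. [:-z, 1:])) x \<le> 0)"
    using sign_change_set[OF pderiv_P_nz] by blast
  define q where "q = (\<Prod>z\<in>A. [:-z, 1:])"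
  have "q \<noteq> 0" unfolding q_def using A(1) by auto
  have dq: "degree q = card A"
    unfolding q_def by (subst degree_prod_eq_sum_degree) auto
  have "\<not> card A < N - 1"
  proof
    assume "card A < N - 1"
    then have 0: "pint (W * pderiv P * q) = 0"
      by (intro pderiv_orthogonal) (simp add: dq)
    have W: "poly W x \<ge> 0" if "x \<in> {-1..1}" for x
      using that abs_square_le_1[of x] by (simp add: power2_eq_square abs_le_iff)
    have eq: "poly (W * pderiv P * q) x = poly W x * poly (pderiv P * q) x" for x
      by (simp only: poly_mult mult.assoc)
    from sgn have "W * pderiv P * q = 0"
    proof
      assume "\<forall>x\<in>{-1..1}. poly (pderiv P * (\<Prod>z\<in>A. [:-z, 1:])) x \<ge> 0"
      then show ?thesis
        using 0 W unfolding q_def[symmetric]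
        by (intro pint_eq_0D) (simp_all only: eq mult_nonneg_nonneg)
    next
      assume "\<forall>x\<in>{-1..1}. poly (pderiv P * (\<Prod>z\<in>A. [:-z, 1:])) x \<le> 0"
      then have "- (W * pderiv P * q) = 0"
        using 0 W unfolding q_def[symmetric]
        by (intro pint_eq_0D)
           (simp_all only: eq poly_minus pint_minus neg_0_le_iff_le minus_zero mult_nonneg_nonpos)
      then show ?thesis by simp
    qed
    then show False
      using pderiv_P_nz \<open>q \<noteq> 0\<close> by simp
  qed
  moreover have "card ?R \<le> N - 1"
    using card_poly_roots_bound[OF pderiv_P_nz] by (simp add: degree_pderiv degree_P)
  moreover have "finite ?R" using pderiv_P_nz by (rule poly_roots_finite)
  moreover have "A \<subseteq> ?R" using A by auto
  ultimately have "A = ?R" by (intro card_seteq) auto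
  then show "card ?R = N - 1" and "?R \<subseteq> {-1<..<1}"
    using \<open>\<not> card A < N - 1\<close> \<open>card ?R \<le> N - 1\<close> A(2) by simp_all
qed

lemma poly_P_1_nz: "poly P 1 \<noteq> 0"
  using endpoint_square(1) pint_PP_pos by auto

lemma orthogonal_poly_smult: "c \<noteq> 0 \<Longrightarrow> orthogonal_poly N (smult c P)"
  using N_pos degree_P orth by unfold_locales (auto simp: pint_smult)

end

lemma orthogonal_poly_legendre: "0 < N \<Longrightarrow> orthogonal_poly N (legendre N)"
  by unfold_locales (auto intro: legendre_orthogonal)

section \<open>Gauss-Lobatto quadrature\<close>

definition lagrange_basis :: "(nat \<Rightarrow> real) \<Rightarrow> nat \<Rightarrow> nat \<Rightarrow> real poly" where
  "lagrange_basis x n i = (\<Prod>j\<in>{..n} - {i}. smult (1 / (x i - x j)) [:- x j, 1:])"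

lemma poly_lagrange_basis:
  assumes "inj_on x {..n}" "i \<le> n" "j \<le> n"
  shows "poly (lagrange_basis x n i) (x j) = (if i = j then 1 else 0)"
proof (cases "i = j")
  case True
  then show ?thesis
    using assms
    by (auto simp: lagrange_basis_def poly_prod inj_on_def diff_divide_distrib[symmetric]
        intro!: prod.neutral split: if_splits)
next
  case False
  then show ?thesis
    using assms by (auto simp: lagrange_basis_def poly_prod intro!: prod_zero bexI[of _ j])
qed

lemma degree_lagrange_basis: "i \<le> n \<Longrightarrow> degree (lagrange_basis x n i) \<le> n"
proof -
  assume "i \<le> n"
  have "degree (lagrange_basis x n i) \<le> (\<Sum>j\<in>{..n} - {i}. degree (smult (1 / (x i - x j)) [:- x j, 1:]))"
    unfolding lagrange_basis_def
    by (rule order.trans[OF degree_prod_sum_le]) (auto simp: o_def)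
  also have "\<dots> \<le> (\<Sum>j\<in>{..n} - {i}. 1)"
    by (intro sum_mono order.trans[OF degree_smult_le]) auto
  also have "\<dots> = n"
    using \<open>i \<le> n\<close> by simp
  finally show ?thesis .
qed

lemma degree_interpolation:
  "degree (\<Sum>i\<le>n. smult (c i) (lagrange_basis x n i)) \<le> n"
  by (intro degree_sum_le) (auto intro: order.trans[OF degree_smult_le] degree_lagrange_basis)

lemma poly_interpolation:
  assumes "inj_on x {..n}" "j \<le> n"
  shows "poly (\<Sum>i\<le>n. smult (c i) (lagrange_basis x n i)) (x j) = c j"
proof -
  have "poly (\<Sum>i\<le>n. smult (c i) (lagrange_basis x n i)) (x j) = (\<Sum>i\<le>n. if i = j then c i else 0)"
    unfolding poly_sum using assms by (intro sum.cong) (auto simp: poly_lagrange_basis)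
  then show ?thesis
    using assms by simp
qed

lemma poly_eq_on_nodes:
  fixes p q :: "real poly"
  assumes "inj_on x {..n}" "degree p \<le> n" "degree q \<le> n" "\<And>i. i \<le> n \<Longrightarrow> poly p (x i) = poly q (x i)"
  shows "p = q"
  using assms by (intro poly_eqI_degree[where A = "x ` {..n}"]) (auto simp: card_image)

lemma lagrange_interpolation:
  assumes "inj_on x {..n}" "degree p \<le> n"
  shows "p = (\<Sum>i\<le>n. smult (poly p (x i)) (lagrange_basis x n i))"
  using assms by (intro poly_eq_on_nodes[where x = x]) (auto simp: poly_interpolation[OF assms(1)] degree_interpolation)

text \<open>Serves the list behind \<open>lgl_node\<close>: its first and last entries are the
  endpoints of the interval, and indexing it enumerates all nodes.\<close>

lemma sorted_list_of_set_range:
  fixes S :: "'a :: linorder set"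
  assumes "finite S" "card S = Suc n" "a \<in> S" "b \<in> S" "\<And>x. x \<in> S \<Longrightarrow> a \<le> x \<and> x \<le> b"
  shows "sorted_list_of_set S ! 0 = a" and "sorted_list_of_set S ! n = b"
    and "bij_betw ((!) (sorted_list_of_set S)) {..n} S"
proof -
  let ?l = "sorted_list_of_set S"
  have len: "length ?l = Suc n" using assms by simp
  have set: "set ?l = S" using assms by simp
  have bij: "bij_betw ((!) ?l) {..<length ?l} (set ?l)"
    by (rule bij_betw_nth) auto
  then show "bij_betw ((!) ?l) {..n} S"
    unfolding len set by (simp add: lessThan_Suc_atMost)
  have in_S: "?l ! i \<in> S" if "i \<le> n" for i
    using nth_mem[of i ?l] len set that by auto
  obtain i where i: "i \<le> n" "?l ! i = a"
    using assms(3) len set by (metis in_set_conv_nth less_Suc_eq_le)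
  have "?l ! 0 \<le> ?l ! i"
    using i len by (intro sorted_nth_mono) auto
  then show "?l ! 0 = a"
    using i assms(5)[OF in_S[of 0]] by simp
  obtain j where j: "j \<le> n" "?l ! j = b"
    using assms(4) len set by (metis in_set_conv_nth less_Suc_eq_le)
  have "?l ! j \<le> ?l ! n"
    using j len by (intro sorted_nth_mono) auto
  then show "?l ! n = b"
    using j assms(5)[OF in_S[of n]] by simp
qed

section \<open>Lobatto nodes and existence of exact weights\<close>

context orthogonal_poly
begin

definition nodes :: "real set" where
  "nodes = {x. (1 - x\<^sup>2) * poly (pderiv P) x = 0}"

lemma nodes_eq: "nodes = insert (-1) (insert 1 {x. poly (pderiv P) x = 0})"
  by (auto simp: nodes_def power2_eq_1_iff)

lemma nodes_props:
  shows "finite nodes" and "card nodes = Suc N" and "nodes \<subseteq> {-1..1}"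
proof -
  have fin: "finite {x. poly (pderiv P) x = 0}"
    using pderiv_P_nz by (rule poly_roots_finite)
  then show "finite nodes" by (simp add: nodes_eq)
  have "1 \<notin> {x. poly (pderiv P) x = 0}" "-1 \<notin> {x. poly (pderiv P) x = 0}"
    using roots_pderiv(2) by auto
  then show "card nodes = Suc N"
    unfolding nodes_eq using fin roots_pderiv(1) N_pos by simp
  show "nodes \<subseteq> {-1..1}"
    unfolding nodes_eq using roots_pderiv(2) by auto
qed

definition node :: "nat \<Rightarrow> real" where
  "node i = sorted_list_of_set nodes ! i"

lemma node_0: "node 0 = -1" and node_N: "node N = 1" and bij_node: "bij_betw node {..N} nodes"
proof -
  have "-1 \<in> nodes" "1 \<in> nodes" by (auto simp: nodes_eq)
  moreover have "-1 \<le> x \<and> x \<le> 1" if "x \<in> nodes" for x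
    using nodes_props(3) that by auto
  ultimately show "node 0 = -1" "node N = 1" "bij_betw node {..N} nodes"
    unfolding node_def[abs_def]
    using sorted_list_of_set_range[of nodes N "-1" 1] nodes_props(1,2) by blast+
qed

lemma inj_node: "inj_on node {..N}"
  using bij_node by (rule bij_betw_imp_inj_on)

lemma node_in: "i \<le> N \<Longrightarrow> node i \<in> nodes"
  using bij_node by (auto simp: bij_betw_def)

lemma node_interior:
  assumes "i \<in> {1..<N}"
  shows "poly (pderiv P) (node i) = 0" "node i \<in> {-1<..<1}"
proof -
  have "node i \<noteq> node 0" "node i \<noteq> node N"
    using inj_node assms by (auto simp: inj_on_def)
  then have "node i \<in> {x. poly (pderiv P) x = 0}"
    using node_in[of i] assms by (auto simp: node_0 node_N nodes_eq)
  then show "poly (pderiv P) (node i) = 0" "node i \<in> {-1<..<1}"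
    using roots_pderiv(2) by auto
qed

lemma sum_nodes_split:
  fixes f :: "nat \<Rightarrow> real"
  shows "(\<Sum>i\<le>N. f i) = f 0 + f N + (\<Sum>i\<in>{1..<N}. f i)"
proof -
  have "{..N} = insert 0 (insert N {1..<N})" using N_pos by auto
  then show ?thesis using N_pos by simp
qed

text \<open>The weights are the integrals of the Lagrange basis. Divide \<open>p\<close> by
  \<open>V = W * pderiv P\<close>, which vanishes at all nodes: the quotient has degree below
  \<open>N - 1\<close>, so \<open>V * s\<close> integrates to zero, and the remainder is reproduced
  by interpolation.\<close>

lemma exact_weights_exist:
  "\<exists>w. \<forall>p. degree p \<le> 2 * N - 1 \<longrightarrow> (\<Sum>i\<le>N. poly p (node i) * w i) = pint p"
proof (intro exI allI impI)
  fix p :: "real poly"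
  assume p: "degree p \<le> 2 * N - 1"
  define V where "V = W * pderiv P"
  have "V \<noteq> 0" using pderiv_P_nz by (simp add: V_def)
  have dV: "degree V = N + 1"
    unfolding V_def using pderiv_P_nz N_pos by (subst degree_mult_eq) (auto simp: degree_pderiv degree_P)
  define s where "s = p div V"
  define r where "r = p mod V"
  have ps: "p = V * s + r" by (simp add: s_def r_def)
  have r: "degree r \<le> N"
    using degree_mod_less[OF \<open>V \<noteq> 0\<close>, of p] dV by (auto simp: r_def)
  have "pint (V * s) = 0"
  proof (cases "s = 0")
    case False
    then have "degree (V * s) = N + 1 + degree s"
      using \<open>V \<noteq> 0\<close> by (simp add: degree_mult_eq dV)
    moreover have "degree (V * s) = degree p"
      unfolding ps using r calculation by (intro degree_add_eq_left[symmetric]) auto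
    ultimately have "degree s < N - 1" using p by linarith
    then show ?thesis unfolding V_def by (rule pderiv_orthogonal)
  qed simp
  then have "pint p = pint r" by (simp add: ps pint_add)
  also have "\<dots> = (\<Sum>i\<le>N. poly r (node i) * pint (lagrange_basis node N i))"
    by (subst lagrange_interpolation[OF inj_node r]) (simp add: pint_sum pint_smult)
  also have "\<dots> = (\<Sum>i\<le>N. poly p (node i) * pint (lagrange_basis node N i))"
  proof (intro sum.cong refl)
    fix i assume "i \<in> {..N}"
    then have "poly V (node i) = 0"
      using node_in[of i] by (auto simp: V_def nodes_def power2_eq_square algebra_simps)
    then show "poly r (node i) * pint (lagrange_basis node N i)
        = poly p (node i) * pint (lagrange_basis node N i)"
      by (simp add: ps)
  qed
  finally show "(\<Sum>i\<le>N. poly p (node i) * pint (lagrange_basis node N i)) = pint p" by simp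
qed

end

text \<open>\<open>lgl_weight\<close> is given by a choice, so the weights enter only through
  exactness, from which their values and signs are derived.\<close>

locale gauss_lobatto = orthogonal_poly +
  fixes w :: "nat \<Rightarrow> real"
  assumes P_1: "poly P 1 = 1"
    and exact: "\<And>p. degree p \<le> 2 * N - 1 \<Longrightarrow> (\<Sum>i\<le>N. poly p (node i) * w i) = pint p"
begin

definition dsum :: "real poly \<Rightarrow> real" where
  "dsum p = (\<Sum>i\<le>N. poly p (node i) * w i)"

lemma dsum_exact: "degree p \<le> 2 * N - 1 \<Longrightarrow> dsum p = pint p"
  unfolding dsum_def by (rule exact)

lemma dsum_add: "dsum (p + q) = dsum p + dsum q"
  by (simp add: dsum_def sum.distrib distrib_right)

lemma dsum_smult: "dsum (smult c p) = c * dsum p"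
  by (simp add: dsum_def sum_distrib_left mult.assoc)

lemma dsum_diff: "dsum (p - q) = dsum p - dsum q"
  by (simp add: dsum_def sum_subtractf left_diff_distrib)

lemma P_neg1: "(poly P (-1))\<^sup>2 = 1"
  using endpoint_square P_1 by simp

lemma pint_PP: "pint (P * P) = 2 / (2 * real N + 1)"
  using endpoint_square(1) P_1 by (simp add: field_simps)

lemma pint_P: "pint P = 0"
  using orth[of 1] N_pos by simp

text \<open>Exactness is tested on \<open>(1 + x) P'\<close>, which vanishes at every node except
  \<open>1\<close>.\<close>

lemma weight_N: "w N = 2 / (real N * (real N + 1))"
proof -
  have "dsum ([:1, 1:] * pderiv P) = 2 * (poly (pderiv P) 1) * w N"
    unfolding dsum_def sum_nodes_split
    using node_interior by (simp add: node_0 node_N)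
  moreover have "dsum ([:1, 1:] * pderiv P) = pint (pderiv P * [:1, 1:])"
    using N_pos
    by (subst dsum_exact)
       (simp_all add: degree_mult_leI[of _ 1 _ "N - 1"] degree_pderiv degree_P mult.commute[of "pderiv P"])
  moreover have "pint (pderiv P * [:1, 1:]) = 2"
    by (subst pint_parts) (simp add: pderiv_pCons P_1 pint_P flip: one_pCons)
  ultimately have "real N * (real N + 1) * w N = 2"
    by (simp add: pderiv_endpoints P_1)
  moreover have "real N * (real N + 1) \<noteq> 0" using N_pos by simp
  ultimately show ?thesis by (metis nonzero_mult_div_cancel_left)
qed

text \<open>The mirror image, with \<open>(1 - x) P'\<close>; the common factor
  \<open>poly P (-1)\<close> is nonzero and cancels.\<close>

lemma weight_0: "w 0 = 2 / (real N * (real N + 1))"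
proof -
  have "dsum ([:1, -1:] * pderiv P) = 2 * (poly (pderiv P) (-1)) * w 0"
    unfolding dsum_def sum_nodes_split
    using node_interior by (simp add: node_0 node_N)
  moreover have "dsum ([:1, -1:] * pderiv P) = pint (pderiv P * [:1, -1:])"
    using N_pos
    by (subst dsum_exact)
       (simp_all add: degree_mult_leI[of _ 1 _ "N - 1"] degree_pderiv degree_P mult.commute[of "pderiv P"])
  moreover have "pint (pderiv P * [:1, -1:]) = - 2 * poly P (-1)"
    using orth[of "[:-1:]"] N_pos by (subst pint_parts) (simp add: pderiv_pCons P_1)
  moreover have "poly P (-1) \<noteq> 0" using P_neg1 by auto
  ultimately have "real N * (real N + 1) * w 0 = 2"
    by (simp add: pderiv_endpoints)
  moreover have "real N * (real N + 1) \<noteq> 0" using N_pos by simp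
  ultimately show ?thesis by (metis nonzero_mult_div_cancel_left)
qed

text \<open>At an interior node, test with \<open>W * (q * q)\<close>, where \<open>q\<close>
  vanishes at the other interior nodes. Its degree \<open>2 N - 2\<close> is within exactness, it is
  nonnegative, and only the node \<open>i\<close> contributes to the sum.\<close>

lemma weight_nonneg:
  assumes "i \<le> N"
  shows "w i \<ge> 0"
proof (cases "i \<in> {1..<N}")
  case True
  define q where "q = (\<Prod>j\<in>{1..<N} - {i}. [:- node j, 1:])"
  have "degree q = N - 2"
    unfolding q_def using True by (subst degree_prod_eq_sum_degree) auto
  then have "degree (W * (q * q)) \<le> 2 * N - 1"
    using True by (intro degree_mult_leI[of _ 2 _ "2 * (N - 2)"] degree_mult_leI[of _ "N - 2" _ "N - 2"]) auto
  then have "dsum (W * (q * q)) = pint (W * (q * q))"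
    by (rule dsum_exact)
  also have "pint (W * (q * q)) \<ge> 0"
  proof (rule pint_nonneg)
    fix x :: real assume "x \<in> {-1..1}"
    then have "poly W x \<ge> 0"
      using abs_square_le_1[of x] by (simp add: power2_eq_square abs_le_iff)
    then show "poly (W * (q * q)) x \<ge> 0"
      by (simp only: poly_mult mult_nonneg_nonneg zero_le_square)
  qed
  also have "dsum (W * (q * q)) = (\<Sum>j\<in>{1..<N}. poly (W * (q * q)) (node j) * w j)"
    unfolding dsum_def sum_nodes_split by (simp add: node_0 node_N)
  also have "\<dots> = (\<Sum>j\<in>{1..<N}. if j = i then poly (W * (q * q)) (node i) * w i else 0)"
    by (intro sum.cong) (auto simp: q_def poly_prod)
  also have "\<dots> = poly (W * (q * q)) (node i) * w i"
    using True by simp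
  finally have "0 \<le> poly (W * (q * q)) (node i) * w i" .
  moreover have "poly (W * (q * q)) (node i) > 0"
  proof -
    have "poly W (node i) > 0"
      using node_interior[OF True] abs_square_less_1[of "node i"]
      by (simp add: power2_eq_square abs_less_iff)
    moreover have "poly q (node i) \<noteq> 0"
      using inj_node True by (auto simp: q_def poly_prod inj_on_def)
    ultimately show ?thesis
      by (simp only: poly_mult mult_pos_pos zero_less_mult_iff linorder_neq_iff) auto
  qed
  ultimately show ?thesis
    by (simp add: zero_le_mult_iff)
next
  case False
  with assms have "i = 0 \<or> i = N" by auto
  then show ?thesis by (auto simp: weight_0 weight_N)
qed

lemma dsum_square_nonneg: "dsum (p * p) \<ge> 0"
  unfolding dsum_def by (intro sum_nonneg mult_nonneg_nonneg) (auto intro: weight_nonneg)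

section \<open>The leading Legendre coefficient\<close>

lemma node_bounds: "i \<le> N \<Longrightarrow> node i \<in> {-1..1}"
  using node_in nodes_props(3) by blast

text \<open>For \<open>degree p <= N\<close> this is the coefficient of \<open>P\<close> in the
  Legendre expansion of \<open>p\<close>.\<close>

definition lc :: "real poly \<Rightarrow> real" where
  "lc p = coeff p N / coeff P N"

lemma lc_remainder:
  assumes "degree p \<le> N"
  obtains r where "degree r < N" "p = smult (lc p) P + r"
proof
  show "degree (p - smult (lc p) P) < N"
  proof (rule degree_less_of_coeff)
    show "degree (p - smult (lc p) P) \<le> N"
      using assms degree_P by (intro degree_diff_le) (auto intro: order.trans[OF degree_smult_le])
  qed (use N_pos lead_nz in \<open>auto simp: lc_def\<close>)
qed simp

lemma pint_P_mult: "degree p \<le> N \<Longrightarrow> pint (P * p) = lc p * (2 / (2 * real N + 1))"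
  by (elim lc_remainder) (metis add.right_neutral distrib_left mult_smult_right orth pint_PP pint_add pint_smult)

lemma dsum_P_less: "degree q < N \<Longrightarrow> dsum (P * q) = 0"
  using orth[of q] degree_P by (subst dsum_exact) (auto intro!: degree_mult_leI[of _ N _ "N - 1"])

text \<open>\<open>P * P\<close> has degree \<open>2 N\<close>, one beyond exactness, and the
  quadrature returns \<open>2 / N\<close> in place of \<open>2 / (2 N + 1)\<close>. Discretely,
  \<open>N P\<close> may be replaced by \<open>x P'\<close>, which vanishes at interior nodes, so
  only the endpoints contribute.\<close>

lemma dsum_PP: "dsum (P * P) = 2 / real N"
proof -
  have "dsum (P * ([:0, 1:] * pderiv P))
      = real N * (real N + 1) / 2 * ((poly P (-1))\<^sup>2 * w 0 + w N)"
    unfolding dsum_def sum_nodes_split using node_interior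
    by (simp add: node_0 node_N P_1 pderiv_endpoints power2_eq_square field_simps)
  also have "\<dots> = 2"
    using N_pos by (simp add: P_neg1 weight_0 weight_N)
  finally have "dsum (P * ([:0, 1:] * pderiv P)) = 2" .
  moreover have "dsum (P * ([:0, 1:] * pderiv P - smult (real N) P)) = 0"
    using degree_P N_pos by (intro dsum_P_less degree_euler_less) auto
  ultimately have "real N * dsum (P * P) = 2"
    by (simp add: right_diff_distrib dsum_diff dsum_smult)
  then show ?thesis
    using N_pos by (simp add: field_simps)
qed

lemma dsum_P_mult: "degree p \<le> N \<Longrightarrow> dsum (P * p) = lc p * (2 / real N)"
  by (elim lc_remainder) (metis add.right_neutral distrib_left mult_smult_right dsum_P_less dsum_PP dsum_add dsum_smult)

text \<open>Expresses \<open>lc\<close> by nodal values, the form in which it can be differentiated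
  in time.\<close>

lemma lc_eq_dsum: "degree p \<le> N \<Longrightarrow> lc p = real N / 2 * dsum (P * p)"
  using N_pos by (simp add: dsum_P_mult)

text \<open>The remainder \<open>r\<close> has degree below \<open>N\<close>, so its square is
  integrated exactly; quadrature and integral of \<open>p * p\<close> differ only in the
  \<open>P * P\<close> term.\<close>

lemma square_expand:
  assumes "degree p \<le> N"
  obtains r where "dsum (p * p) = (lc p)\<^sup>2 * (2 / real N) + pint (r * r)"
    and "pint (p * p) = (lc p)\<^sup>2 * (2 / (2 * real N + 1)) + pint (r * r)"
proof -
  from assms obtain r where r: "degree r < N" "p = smult (lc p) P + r"
    by (rule lc_remainder)
  have eq: "p * p = smult ((lc p)\<^sup>2) (P * P) + smult (2 * lc p) (P * r) + r * r"
  proof -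
    have "poly p x = lc p * poly P x + poly r x" for x
      using arg_cong[OF r(2), of "\<lambda>p. poly p x"] by simp
    then show ?thesis
      by (simp add: poly_eq_poly_eq_iff[symmetric] fun_eq_iff power2_eq_square algebra_simps)
  qed
  have "dsum (r * r) = pint (r * r)"
    using r(1) by (intro dsum_exact degree_mult_leI[of _ "N - 1" _ "N - 1"]) auto
  then show ?thesis
    using that[of r] arg_cong[OF eq, of dsum] arg_cong[OF eq, of pint] r(1)
    by (simp add: dsum_add dsum_smult pint_add pint_smult dsum_PP pint_PP dsum_P_less orth)
qed

lemma dsum_square_ge: "degree p \<le> N \<Longrightarrow> dsum (p * p) \<ge> 2 / real N * (lc p)\<^sup>2"
  by (elim square_expand) (use pint_nonneg in \<open>auto simp: mult.commute\<close>)

lemma dsum_square_eq: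
  assumes "degree p \<le> N"
  shows "dsum (p * p) = pint (p * p) + (lc p)\<^sup>2 * (2 / real N - 2 / (2 * real N + 1))"
  using assms by (elim square_expand) (simp add: algebra_simps)

lemma dsum_pderiv_square:
  "degree p \<le> N \<Longrightarrow> dsum (pderiv p * pderiv p) = pint (pderiv p * pderiv p)"
  by (intro dsum_exact degree_mult_leI[of _ "N - 1" _ "N - 1"]) (auto simp: degree_pderiv)

text \<open>Expand \<open>\<integral>(1 - x\<^sup>2) (p' - lc p P')\<^sup>2 \<ge> 0\<close> by means of Legendre's equation.\<close>
lemma dsum_pderiv_square_ge:
  assumes "degree p \<le> N"
  shows "dsum (pderiv p * pderiv p) \<ge> real N * (lc p)\<^sup>2"
proof -
  \<comment> \<open>\<open>K\<close> is the value of
    \<open>pint (W * pderiv P * pderiv P)\<close>.\<close>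
  define K where "K = real N * (real N + 1) * (2 / (2 * real N + 1))"
  let ?d = "pderiv p - smult (lc p) (pderiv P)"
  have W: "poly W x \<ge> 0" "poly W x \<le> 1" if "x \<in> {-1..1}" for x
    using that abs_square_le_1[of x] by (auto simp: power2_eq_square abs_le_iff)
  have lcP: "lc P = 1" using lead_nz by (simp add: lc_def)
  have "0 \<le> pint (W * (?d * ?d))"
    using W by (intro pint_nonneg) (simp only: poly_mult mult_nonneg_nonneg zero_le_square)
  also have "W * (?d * ?d) = W * (pderiv p * pderiv p) - smult (2 * lc p) (W * pderiv P * pderiv p)
      + smult ((lc p)\<^sup>2) (W * pderiv P * pderiv P)"
    by (simp add: poly_eq_poly_eq_iff[symmetric] fun_eq_iff power2_eq_square algebra_simps)
  also have "pint \<dots> = pint (W * (pderiv p * pderiv p)) - (lc p)\<^sup>2 * K"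
    using assms degree_P
    by (simp add: pint_add pint_diff pint_smult pint_W_pderiv_P pint_P_mult lcP K_def power2_eq_square)
  finally have "(lc p)\<^sup>2 * K \<le> pint (W * (pderiv p * pderiv p))" by simp
  also have "\<dots> \<le> pint (pderiv p * pderiv p)"
  proof -
    have "0 \<le> pint ((1 - W) * (pderiv p * pderiv p))"
      using W by (intro pint_nonneg) (simp only: poly_mult poly_diff poly_1 mult_nonneg_nonneg zero_le_square diff_ge_0_iff_ge)
    then show ?thesis by (simp add: left_diff_distrib pint_diff)
  qed
  also have "\<dots> = dsum (pderiv p * pderiv p)"
    using assms by (simp add: dsum_pderiv_square)
  finally have "(lc p)\<^sup>2 * K \<le> dsum (pderiv p * pderiv p)" .
  moreover have "real N \<le> K" by (simp add: K_def field_simps)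
  then have "real N * (lc p)\<^sup>2 \<le> (lc p)\<^sup>2 * K"
    by (metis mult.commute mult_left_mono zero_le_power2)
  ultimately show ?thesis by linarith
qed

section \<open>Multiplier identities\<close>

text \<open>Here \<open>c\<close> is the acceleration: it follows the equation at interior nodes but
  is zero at the endpoints. Completing the sum to a full quadrature costs the endpoint terms, which
  is how the weighted values of \<open>phi_xx\<close> enter.\<close>

lemma weighted_sum_collocation:
  assumes "c 0 = 0" "c N = 0" "\<And>i. i \<in> {1..<N} \<Longrightarrow> c i = poly r (node i)"
  shows "(\<Sum>i\<le>N. poly f (node i) * c i * w i)
    = dsum (f * r) - 2 / (real N * (real N + 1)) * (poly f 1 * poly r 1 + poly f (-1) * poly r (-1))"
  unfolding dsum_def sum_nodes_split using assms
  by (simp add: node_0 node_N weight_0 weight_N ring_distribs)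

text \<open>The product \<open>p (1 + x) p'\<close> has degree \<open>2 N\<close>, just beyond the exactness of the
  quadrature; subtracting \<open>N p\<^sup>2\<close> removes its leading term.\<close>
lemma dsum_transport:
  assumes p: "degree p \<le> N" "poly p 1 = 0" "poly p (-1) = 0"
  shows "dsum (p * ([:1, 1:] * pderiv p)) = - (dsum (p * p) / 2) + (real N + 1) / real N * (lc p)\<^sup>2"
proof -
  have dp: "degree (p * pderiv p) \<le> 2 * N - 1"
    using p N_pos by (intro degree_mult_leI[of _ N _ "N - 1"]) (auto simp: degree_pderiv)
  have "pint (p * pderiv p) = 0"
    using pint_parts[of p p] p by (simp add: mult.commute)
  then have 1: "dsum (p * pderiv p) = 0"
    using dsum_exact[OF dp] by simp
  have "degree (p * ([:0, 1:] * pderiv p - smult (real N) p)) \<le> 2 * N - 1"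
    using p N_pos degree_euler_less[OF p(1) N_pos] by (intro degree_mult_leI[of _ N _ "N - 1"]) auto
  then have 2: "dsum (p * ([:0, 1:] * pderiv p)) - real N * dsum (p * p)
      = pint (p * ([:0, 1:] * pderiv p)) - real N * pint (p * p)"
    using dsum_exact by (fastforce simp: right_diff_distrib dsum_diff dsum_smult pint_diff pint_smult)
  have "pint (pderiv p * ([:0, 1:] * p)) = - pint (p * p) - pint (p * ([:0, 1:] * pderiv p))"
    using p by (subst pint_parts)
      (simp add: pderiv_mult pderiv_pCons pint_add algebra_simps flip: one_pCons)
  moreover have "pderiv p * ([:0, 1:] * p) = p * ([:0, 1:] * pderiv p)"
    by (simp add: mult_ac)
  ultimately have 3: "pint (p * ([:0, 1:] * pderiv p)) = - (pint (p * p) / 2)"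
    by (simp add: mult_ac)
  have 4: "dsum (p * p) = pint (p * p) + (lc p)\<^sup>2 * (2 / real N - 2 / (2 * real N + 1))"
    by (rule dsum_square_eq[OF p(1)])
  have "p * ([:1, 1:] * pderiv p) = p * pderiv p + p * ([:0, 1:] * pderiv p)"
    by (simp add: poly_eq_poly_eq_iff[symmetric] fun_eq_iff algebra_simps)
  then have "dsum (p * ([:1, 1:] * pderiv p)) = real N * dsum (p * p) - (real N + 1/2) * pint (p * p)"
    using 1 2 3 by (simp add: dsum_add algebra_simps)
  \<comment> \<open>Isolates the quadrature defect of \<open>p * p\<close>, a multiple of
    \<open>(lc p)^2\<close> by \<open>4\<close>.\<close>
  also have "\<dots> = - (dsum (p * p) / 2) + (real N + 1/2) * (dsum (p * p) - pint (p * p))"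
    by (simp add: algebra_simps)
  also have "(real N + 1/2) * (dsum (p * p) - pint (p * p)) = (real N + 1) / real N * (lc p)\<^sup>2"
  proof -
    have "(real N + 1/2) * (2 / real N - 2 / (2 * real N + 1)) = (real N + 1) / real N"
      using N_pos by (simp add: divide_simps) (simp add: algebra_simps)
    then have "(real N + 1/2) * (2 / real N - 2 / (2 * real N + 1)) * (lc p)\<^sup>2
        = (real N + 1) / real N * (lc p)\<^sup>2"
      by simp
    then show ?thesis by (simp only: 4 add_diff_cancel_left' mult_ac)
  qed
  finally show ?thesis .
qed

text \<open>Quadrature is exact on this product, and \<open>2 (1 + x) p' p''\<close> is the
  derivative of \<open>(1 + x) p'^2\<close> minus \<open>p'^2\<close>.\<close>

lemma dsum_space_multiplier:
  assumes "degree p \<le> N"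
  shows "dsum ([:1, 1:] * pderiv p * pderiv (pderiv p))
    = (poly (pderiv p) 1)\<^sup>2 - dsum (pderiv p * pderiv p) / 2"
proof (cases "pderiv (pderiv p) = 0")
  case True
  then obtain c where c: "pderiv p = [:c:]"
    by (auto simp: pderiv_eq_0_iff elim: degree_eq_zeroE)
  have "pint [:c * c:] = 2 * c\<^sup>2"
    using pint_pderiv[of "[:0, c * c:]"] by (simp add: pderiv_pCons power2_eq_square)
  then show ?thesis
    using dsum_pderiv_square[OF assms] by (simp add: c mult_pCons_left) (simp add: dsum_def)
next
  case False
  then have "degree (pderiv p) \<noteq> 0" by (simp add: pderiv_eq_0_iff)
  then have d: "2 \<le> degree p" by (simp add: degree_pderiv)
  have "degree ([:1, 1:] * pderiv p * pderiv (pderiv p)) \<le> 2 * N - 1"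
    using assms d by (intro degree_mult_leI[of _ N _ "N - 2"] degree_mult_leI[of _ 1 _ "N - 1"])
      (auto simp: degree_pderiv)
  then have "dsum ([:1, 1:] * pderiv p * pderiv (pderiv p)) = pint ([:1, 1:] * pderiv p * pderiv (pderiv p))"
    by (rule dsum_exact)
  also have "2 * \<dots> = 2 * (poly (pderiv p) 1)\<^sup>2 - pint (pderiv p * pderiv p)"
  proof -
    have "pderiv ([:1, 1:] * (pderiv p * pderiv p))
        = pderiv p * pderiv p + smult 2 ([:1, 1:] * pderiv p * pderiv (pderiv p))"
      by (simp add: pderiv_mult pderiv_pCons poly_eq_poly_eq_iff[symmetric] fun_eq_iff algebra_simps)
    then show ?thesis
      using pint_pderiv[of "[:1, 1:] * (pderiv p * pderiv p)"]
      by (simp add: pint_add pint_smult power2_eq_square)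
  qed
  finally show ?thesis
    using dsum_pderiv_square[OF assms] by simp
qed

text \<open>Discrete integration by parts: the quadrature is exact on \<open>(p' q)'\<close>, and
  \<open>q\<close> vanishes at the endpoints.\<close>

lemma dsum_energy:
  assumes "degree p \<le> N" "degree q \<le> N" "poly q 1 = 0" "poly q (-1) = 0"
  shows "dsum (pderiv p * pderiv q) + dsum (q * pderiv (pderiv p)) = 0"
proof -
  have "degree (pderiv p * q) \<le> 2 * N - 1"
    using assms N_pos by (intro degree_mult_leI[of _ "N - 1" _ N]) (auto simp: degree_pderiv)
  then have "degree (pderiv (pderiv p * q)) \<le> 2 * N - 1"
    by (simp add: degree_pderiv)
  then have "dsum (pderiv (pderiv p * q)) = 0"
    using assms by (simp add: dsum_exact pint_pderiv)
  then show ?thesis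
    by (simp add: pderiv_mult dsum_add mult.commute)
qed

end

section \<open>Elementary inequalities\<close>

text \<open>For \<open>d = phi_x(1)\<close>, \<open>y1 = phi_xx(1)\<close>,
  \<open>y2 = phi_xx(-1)\<close>, \<open>s = P(-1)\<close> and \<open>b = lc phi\<close>, the left
  side is the rate of the flux below. Absorbing the two products with \<open>b\<close> costs
  \<open>e1 / 16\<close>, and \<open>1/2 - 1/16 = 7/16\<close> explains the factor
  \<open>7 / 8\<close>.\<close>

lemma multiplier_flux_bound:
  fixes n b d y1 y2 s e1 e2 :: real
  assumes n: "n \<ge> 1" and s: "s\<^sup>2 = 1" and e1: "n * b\<^sup>2 \<le> e1" and e2: "0 \<le> e2"
    and om: "om = 2 / (n * (n + 1))"
  shows "d\<^sup>2 - e1 / 2 - 2 * om * y1 * d - e2 / 2 + b / n * (y1 + s * y2)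
    \<le> 8 * ((d - om * y1)\<^sup>2 + om * y1\<^sup>2 + om * y2\<^sup>2) - 7 / 8 * ((e1 + e2) / 2)"
proof -
  have young: "b / n * y \<le> n * b\<^sup>2 / 32 + 8 * om * y\<^sup>2" for y
  proof -
    \<comment> \<open>Young's inequality, weighted so that the \<open>b\<close> part is
      \<open>n b^2 / 32\<close>; the \<open>y\<close> part then carries \<open>8 / n^3\<close>,
      which is at most \<open>8 * om\<close>.\<close>
    have "0 \<le> n / 32 * (b - 16 * y / n\<^sup>2)\<^sup>2" using n by simp
    also have "\<dots> = n * b\<^sup>2 / 32 + 8 * y\<^sup>2 / n ^ 3 - b / n * y"
      using n by (simp add: field_simps power2_eq_square power3_eq_cube)
    finally have "b / n * y \<le> n * b\<^sup>2 / 32 + 8 * y\<^sup>2 * (1 / n ^ 3)" by simp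
    also have "1 / n ^ 3 \<le> om"
    proof -
      have "n * 1 \<le> n * n" using n by (intro mult_left_mono) auto
      then have "n + 1 \<le> 2 * (n * n)" using n by linarith
      then have "n * (n + 1) \<le> 2 * n ^ 3"
        using n mult_left_mono[of "n + 1" "2 * (n * n)" n] by (simp add: power3_eq_cube mult_ac)
      then have "2 / (2 * n ^ 3) \<le> om"
        unfolding om using n by (intro divide_left_mono) auto
      then show ?thesis by simp
    qed
    then have "8 * y\<^sup>2 * (1 / n ^ 3) \<le> 8 * y\<^sup>2 * om" by (intro mult_left_mono) auto
    finally show ?thesis by (simp add: mult_ac)
  qed
  have "(s * y2)\<^sup>2 = y2\<^sup>2" by (simp add: power_mult_distrib s)
  then have "b / n * (y1 + s * y2) \<le> n * b\<^sup>2 / 16 + 8 * (om * y1\<^sup>2) + 8 * (om * y2\<^sup>2)"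
    using young[of y1] young[of "s * y2"] by (simp add: distrib_left)
  moreover have "d\<^sup>2 - 2 * om * y1 * d \<le> (d - om * y1)\<^sup>2"
    using zero_le_power2[of "om * y1"] by (simp add: power2_eq_square algebra_simps)
  \<comment> \<open>The nonlinear terms are replaced by letters, so that what remains is linear:
    \<open>D\<close> is \<open>n b^2\<close>, \<open>S\<close> the observed square, and
    \<open>A\<close>, \<open>B\<close> are the weighted squares of \<open>y1\<close>,
    \<open>y2\<close>.\<close>
  moreover have "F - e1 / 2 - e2 / 2 + U \<le> 8 * (S + A + B) - 7 / 8 * ((e1 + e2) / 2)"
    if "U \<le> D / 16 + 8 * A + 8 * B" "F \<le> S" "D \<le> e1" "0 \<le> S" for A B D F S U :: real
    using that e2 by (simp add: field_simps)
  note this[OF calculation e1 zero_le_power2]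
  ultimately show ?thesis
    by (simp only: diff_right_commute)
qed

lemma leading_coeff_cross_bound:
  fixes n b b1 e1 e2 :: real
  assumes n: "n \<ge> 1" and e1: "n * b\<^sup>2 \<le> e1" and e2: "2 / n * b1\<^sup>2 \<le> e2"
  shows "\<bar>(n + 1) / n * (b * b1)\<bar> \<le> 10 / 7 * ((e1 + e2) / 2)"
proof -
  \<comment> \<open>\<open>7 / 5\<close> is a rational value just below \<open>sqrt 2\<close>:
    \<open>49/25 + 1/25 = 2\<close> completes the coefficient of \<open>b1^2\<close>. The resulting
    \<open>14 / 5\<close> and the bound \<open>(n + 1) / n <= 2\<close> give
    \<open>10 / 7\<close>.\<close>
  have "0 \<le> (n * \<bar>b\<bar> - 7 / 5 * \<bar>b1\<bar>)\<^sup>2 + 1 / 25 * b1\<^sup>2" by simp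
  also have "\<dots> = n * (n * b\<^sup>2 + 2 / n * b1\<^sup>2 - 14 / 5 * \<bar>b * b1\<bar>)"
    using n by (simp add: power2_eq_square algebra_simps abs_mult)
  finally have "0 \<le> n * b\<^sup>2 + 2 / n * b1\<^sup>2 - 14 / 5 * \<bar>b * b1\<bar>"
    using n by (simp add: zero_le_mult_iff)
  moreover have "2 * c \<le> 10 / 7 * ((e1 + e2) / 2)"
    if "0 \<le> A + B - 14 / 5 * c" "A \<le> e1" "B \<le> e2" for A B c
    using that by (simp add: field_simps)
  ultimately have *: "2 * \<bar>b * b1\<bar> \<le> 10 / 7 * ((e1 + e2) / 2)"
    using e1 e2 by blast
  have "(n + 1) / n \<le> 2" using n by (simp add: field_simps)
  then have "(n + 1) / n * \<bar>b * b1\<bar> \<le> 2 * \<bar>b * b1\<bar>"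
    by (rule mult_right_mono) simp
  moreover have "\<bar>(n + 1) / n * (b * b1)\<bar> = (n + 1) / n * \<bar>b * b1\<bar>"
    using n by (subst abs_mult) simp
  ultimately show ?thesis using * by (metis order.trans)
qed

section \<open>Observability\<close>

text \<open>Velocity and acceleration are recorded by node index, since only nodal values enter the
  equation; \<open>psi\<close> below recovers a polynomial velocity.\<close>

locale collocation_wave = gauss_lobatto +
  fixes T :: real and phi :: "real \<Rightarrow> real poly" and v a :: "real \<Rightarrow> nat \<Rightarrow> real"
  assumes T_pos: "T > 0"
    and degree_phi: "\<And>t. t \<in> {0..T} \<Longrightarrow> degree (phi t) \<le> N"
    and phi_boundary: "\<And>t. t \<in> {0..T} \<Longrightarrow> poly (phi t) 1 = 0"
      "\<And>t. t \<in> {0..T} \<Longrightarrow> poly (phi t) (-1) = 0"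
    and phi_deriv: "\<And>i t. i \<le> N \<Longrightarrow> t \<in> {0..T} \<Longrightarrow>
      ((\<lambda>s. poly (phi s) (node i)) has_real_derivative v t i) (at t within {0..T})"
    and v_cont: "\<And>i. i \<le> N \<Longrightarrow> continuous_on {0..T} (\<lambda>t. v t i)"
    and v_deriv: "\<And>i t. i \<le> N \<Longrightarrow> t \<in> {0<..<T} \<Longrightarrow> ((\<lambda>s. v s i) has_real_derivative a t i) (at t)"
    and wave: "\<And>i t. i \<in> {1..<N} \<Longrightarrow> t \<in> {0<..<T} \<Longrightarrow> a t i = poly (pderiv (pderiv (phi t))) (node i)"
begin

section \<open>The velocity polynomial and time derivatives\<close>

lemma v_boundary:
  assumes t: "t \<in> {0..T}"
  shows "v t 0 = 0" "v t N = 0"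
proof -
  have "v t i = 0" if "i \<le> N" "node i = 1 \<or> node i = -1" for i
  proof -
    have "((\<lambda>s. poly (phi s) (node i)) has_vector_derivative v t i) (at t within {0..T})"
      using phi_deriv[OF that(1) t] by (simp add: has_real_derivative_iff_has_vector_derivative)
    moreover have "((\<lambda>s. poly (phi s) (node i)) has_vector_derivative 0) (at t within {0..T})"
      using t that phi_boundary
      by (intro has_vector_derivative_transform[OF _ _ has_vector_derivative_const[of 0]]) auto
    ultimately show ?thesis
      using T_pos t vector_derivative_unique_within_closed_interval[of 0 T t] by auto
  qed
  then show "v t 0 = 0" "v t N = 0" by (simp_all add: node_0 node_N)
qed

lemma a_boundary:
  assumes t: "t \<in> {0<..<T}"
  shows "a t 0 = 0" "a t N = 0"
proof -
  have "a t i = 0" if "i \<le> N" "\<And>s. s \<in> {0..T} \<Longrightarrow> v s i = 0" for i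
  proof (rule DERIV_unique[OF v_deriv[OF that(1) t]])
    show "((\<lambda>s. v s i) has_real_derivative 0) (at t)"
      using t that
      by (intro has_field_derivative_transform_within_open[OF DERIV_const[of 0], of "{0<..<T}"]) auto
  qed
  then show "a t 0 = 0" "a t N = 0" using v_boundary by auto
qed

text \<open>On \<open>{0..T}\<close> this is the time derivative of \<open>phi\<close> as a
  polynomial in space, by \<open>higher_pderiv_phi_deriv\<close>.\<close>

definition psi :: "real \<Rightarrow> real poly" where
  "psi t = (\<Sum>i\<le>N. smult (v t i) (lagrange_basis node N i))"

lemma degree_psi: "degree (psi t) \<le> N"
  unfolding psi_def by (rule degree_interpolation)

lemma psi_node: "i \<le> N \<Longrightarrow> poly (psi t) (node i) = v t i"
  unfolding psi_def by (rule poly_interpolation[OF inj_node])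

lemma psi_boundary: "t \<in> {0..T} \<Longrightarrow> poly (psi t) 1 = 0" "t \<in> {0..T} \<Longrightarrow> poly (psi t) (-1) = 0"
  using psi_node[of N t] psi_node[of 0 t] v_boundary[of t] by (auto simp: node_0 node_N)

text \<open>Space derivatives at any point are fixed linear combinations of nodal values.\<close>
lemma higher_pderiv_phi_deriv:
  assumes t: "t \<in> {0..T}"
  shows "((\<lambda>s. poly ((pderiv ^^ k) (phi s)) y) has_real_derivative poly ((pderiv ^^ k) (psi t)) y)
    (at t within {0..T})"
proof -
  let ?l = "\<lambda>i. poly ((pderiv ^^ k) (lagrange_basis node N i)) y"
  have "((\<lambda>s. \<Sum>i\<le>N. poly (phi s) (node i) * ?l i) has_real_derivative (\<Sum>i\<le>N. v t i * ?l i))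
      (at t within {0..T})"
    by (intro DERIV_sum DERIV_cmult_right phi_deriv t) auto
  moreover have "(\<Sum>i\<le>N. v t i * ?l i) = poly ((pderiv ^^ k) (psi t)) y"
    by (simp add: psi_def higher_pderiv_sum higher_pderiv_smult poly_sum)
  moreover have "poly ((pderiv ^^ k) (phi s)) y = (\<Sum>i\<le>N. poly (phi s) (node i) * ?l i)" if "s \<in> {0..T}" for s
    by (subst lagrange_interpolation[OF inj_node degree_phi[OF that]])
       (simp add: higher_pderiv_sum higher_pderiv_smult poly_sum)
  ultimately show ?thesis
    using t by (auto elim: has_field_derivative_transform_within[OF _ zero_less_one])
qed

lemmas phi_x_deriv_within = higher_pderiv_phi_deriv[where k = 1, simplified]

lemma at_interior: "t \<in> {0<..<T} \<Longrightarrow> at t within {0..T} = at t"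
  by (intro at_within_interior) auto

lemma phi_x_deriv:
  "t \<in> {0<..<T} \<Longrightarrow> ((\<lambda>s. poly (pderiv (phi s)) y) has_real_derivative poly (pderiv (psi t)) y) (at t)"
  using phi_x_deriv_within[of t y] by (simp add: at_interior)

lemma phi_node_deriv:
  "i \<le> N \<Longrightarrow> t \<in> {0<..<T} \<Longrightarrow> ((\<lambda>s. poly (phi s) (node i)) has_real_derivative v t i) (at t)"
  using phi_deriv[of i t] by (simp add: at_interior)

lemma phi_cont:
  "continuous_on {0..T} (\<lambda>t. poly ((pderiv ^^ k) (phi t)) y)"
  by (rule DERIV_continuous_on[OF higher_pderiv_phi_deriv])

lemmas phi_node_cont = phi_cont[where k = 0, simplified]
lemmas phi_x_cont = phi_cont[where k = 1, simplified]
lemmas phi_xx_cont = phi_cont[where k = 2, simplified numeral_2_eq_2 funpow.simps o_apply id_apply]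

section \<open>Conservation of the discrete energy\<close>

definition energy :: "real \<Rightarrow> real" where
  "energy t = (dsum (pderiv (phi t) * pderiv (phi t)) + dsum (psi t * psi t)) / 2"

lemma energy_sum:
  "energy t = (\<Sum>i\<le>N. ((poly (pderiv (phi t)) (node i))\<^sup>2 + (v t i)\<^sup>2) * w i) / 2"
  unfolding energy_def dsum_def by (simp add: psi_node power2_eq_square sum.distrib distrib_right)

text \<open>The wave equation may be inserted into the quadrature without endpoint terms because
  \<open>psi\<close> vanishes at both ends; discrete integration by parts then cancels the
  rest.\<close>

lemma energy_const:
  assumes "t \<in> {0..T}"
  shows "energy t = energy 0"
proof (rule DERIV_isconst2[OF T_pos])
  show "continuous_on {0..T} energy"
    unfolding energy_sum by (intro continuous_intros phi_x_cont v_cont) auto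
  fix t assume "0 < t" "t < T"
  then have t: "t \<in> {0<..<T}" "t \<in> {0..T}" by auto
  have "(energy has_real_derivative (\<Sum>i\<le>N. (2 * (poly (pderiv (phi t)) (node i) * poly (pderiv (psi t)) (node i))
      + 2 * (v t i * a t i)) * w i) / 2) (at t)"
    unfolding energy_sum
    by (intro DERIV_cdivide DERIV_sum DERIV_cmult_right)
       (auto intro!: derivative_eq_intros phi_x_deriv v_deriv t simp: mult_ac)
  also have "(\<Sum>i\<le>N. (2 * (poly (pderiv (phi t)) (node i) * poly (pderiv (psi t)) (node i))
      + 2 * (v t i * a t i)) * w i) / 2
      = dsum (pderiv (phi t) * pderiv (psi t)) + (\<Sum>i\<le>N. poly (psi t) (node i) * a t i * w i)"
    unfolding dsum_def
    by (simp add: psi_node sum.distrib distrib_right sum_divide_distrib add_divide_distrib mult.assoc)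
  also have "(\<Sum>i\<le>N. poly (psi t) (node i) * a t i * w i) = dsum (psi t * pderiv (pderiv (phi t)))"
    using t by (subst weighted_sum_collocation[OF a_boundary[OF t(1)] wave]) (auto simp: psi_boundary)
  also have "dsum (pderiv (phi t) * pderiv (psi t)) + \<dots> = 0"
    using t by (intro dsum_energy degree_phi degree_psi psi_boundary)
  finally show "(energy has_real_derivative 0) (at t)" .
qed (use assms in auto)

text \<open>The first sum is the multiplier \<open>(1 + x) \<phi>\<^sub>x\<close>; the second term removes the
  quadrature error \<open>(lc \<psi>)\<^sup>2\<close> of \<open>dsum_transport\<close>, which has the wrong sign.\<close>
definition flux :: "real \<Rightarrow> real" where
  "flux t = (\<Sum>i\<le>N. (1 + node i) * (poly (pderiv (phi t)) (node i) * v t i) * w i)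
     - (real N + 1) / real N * (lc (phi t) * lc (psi t))"

abbreviation "om \<equiv> 2 / (real N * (real N + 1))"

text \<open>The time derivative of \<open>flux\<close> after simplification; it no longer contains
  \<open>lc (psi t)\<close>.\<close>

definition flux_rate :: "real \<Rightarrow> real" where
  "flux_rate t = (poly (pderiv (phi t)) 1)\<^sup>2 - dsum (pderiv (phi t) * pderiv (phi t)) / 2
     - 2 * om * poly (pderiv (pderiv (phi t))) 1 * poly (pderiv (phi t)) 1 - dsum (psi t * psi t) / 2
     + lc (phi t) / real N * (poly (pderiv (pderiv (phi t))) 1 + poly P (-1) * poly (pderiv (pderiv (phi t))) (-1))"

lemma lc_phi: "t \<in> {0..T} \<Longrightarrow> lc (phi t) = real N / 2 * (\<Sum>i\<le>N. poly P (node i) * poly (phi t) (node i) * w i)"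
  using lc_eq_dsum[OF degree_phi, of t] by (simp add: dsum_def)

lemma lc_psi: "lc (psi t) = real N / 2 * (\<Sum>i\<le>N. poly P (node i) * v t i * w i)"
  using lc_eq_dsum[OF degree_psi, of t] by (simp add: dsum_def psi_node)

lemma lc_phi_deriv:
  assumes "t \<in> {0<..<T}"
  shows "((\<lambda>s. lc (phi s)) has_real_derivative lc (psi t)) (at t)"
proof (rule has_field_derivative_transform_within_open[where S = "{0<..<T}"])
  show "((\<lambda>s. real N / 2 * (\<Sum>i\<le>N. poly P (node i) * poly (phi s) (node i) * w i)) has_real_derivative lc (psi t)) (at t)"
    unfolding lc_psi
    by (intro DERIV_cmult DERIV_sum DERIV_cmult_right phi_node_deriv assms) auto
qed (use assms lc_phi in auto)

text \<open>Tests the equation with \<open>P\<close>: \<open>phi_xx\<close> has degree below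
  \<open>N\<close> and is discretely orthogonal to \<open>P\<close>, so only endpoint corrections
  survive.\<close>

lemma lc_psi_deriv:
  assumes t: "t \<in> {0<..<T}"
  shows "((\<lambda>s. lc (psi s)) has_real_derivative
    - (poly (pderiv (pderiv (phi t))) 1 + poly P (-1) * poly (pderiv (pderiv (phi t))) (-1)) / (real N + 1)) (at t)"
proof -
  let ?r = "pderiv (pderiv (phi t))"
  have "((\<lambda>s. lc (psi s)) has_real_derivative real N / 2 * (\<Sum>i\<le>N. poly P (node i) * a t i * w i)) (at t)"
    unfolding lc_psi
    by (intro DERIV_cmult DERIV_sum DERIV_cmult_right v_deriv t) auto
  also have "(\<Sum>i\<le>N. poly P (node i) * a t i * w i) = dsum (P * ?r) - om * (poly ?r 1 + poly P (-1) * poly ?r (-1))"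
    using t by (subst weighted_sum_collocation[OF a_boundary[OF t] wave]) (auto simp: P_1)
  also have "dsum (P * ?r) = 0"
    using degree_phi[of t] t N_pos by (intro dsum_P_less) (auto simp: degree_pderiv)
  also have "real N / 2 * (0 - om * (poly ?r 1 + poly P (-1) * poly ?r (-1)))
      = - (poly ?r 1 + poly P (-1) * poly ?r (-1)) / (real N + 1)"
    using N_pos by (simp add: divide_simps) (simp add: algebra_simps)
  finally show ?thesis .
qed

lemma flux_deriv:
  assumes t: "t \<in> {0<..<T}"
  shows "(flux has_real_derivative flux_rate t) (at t)"
proof -
  let ?q = "pderiv (phi t)" and ?r = "pderiv (pderiv (phi t))"
  let ?z = "poly ?r 1 + poly P (-1) * poly ?r (-1)"
  have t': "t \<in> {0..T}" using t by auto
  have "(flux has_real_derivative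
      (\<Sum>i\<le>N. (1 + node i) * (poly ?q (node i) * a t i + poly (pderiv (psi t)) (node i) * v t i) * w i)
      - (real N + 1) / real N * (lc (phi t) * (- ?z / (real N + 1)) + lc (psi t) * lc (psi t))) (at t)"
    unfolding flux_def
    by (intro DERIV_diff DERIV_cmult DERIV_sum DERIV_cmult_right DERIV_mult' phi_x_deriv v_deriv
          lc_phi_deriv lc_psi_deriv t) auto
  \<comment> \<open>Separates the acceleration part, where the equation is inserted, from the
    transport part in \<open>psi\<close>.\<close>
  also have "(\<Sum>i\<le>N. (1 + node i) * (poly ?q (node i) * a t i + poly (pderiv (psi t)) (node i) * v t i) * w i)
      = (\<Sum>i\<le>N. poly ([:1, 1:] * ?q) (node i) * a t i * w i) + dsum (psi t * ([:1, 1:] * pderiv (psi t)))"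
    unfolding dsum_def by (simp add: psi_node sum.distrib algebra_simps)
  also have "(\<Sum>i\<le>N. poly ([:1, 1:] * ?q) (node i) * a t i * w i)
      = dsum ([:1, 1:] * ?q * ?r) - om * (2 * poly ?q 1 * poly ?r 1)"
    using t by (subst weighted_sum_collocation[OF a_boundary[OF t] wave]) auto
  also have "dsum ([:1, 1:] * ?q * ?r) = (poly ?q 1)\<^sup>2 - dsum (?q * ?q) / 2"
    using t' by (intro dsum_space_multiplier degree_phi)
  also have "dsum (psi t * ([:1, 1:] * pderiv (psi t)))
      = - (dsum (psi t * psi t) / 2) + (real N + 1) / real N * (lc (psi t))\<^sup>2"
    using t' by (intro dsum_transport degree_psi psi_boundary)
  also have "(poly ?q 1)\<^sup>2 - dsum (?q * ?q) / 2 - om * (2 * poly ?q 1 * poly ?r 1)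
      + (- (dsum (psi t * psi t) / 2) + (real N + 1) / real N * (lc (psi t))\<^sup>2)
      - (real N + 1) / real N * (lc (phi t) * (- ?z / (real N + 1)) + lc (psi t) * lc (psi t)) = flux_rate t"
  proof -
    have "(real N + 1) / real N * (lc (phi t) * (- ?z / (real N + 1))) = - (lc (phi t) / real N * ?z)"
      using N_pos by (simp add: divide_simps) (simp add: algebra_simps)
    then show ?thesis
      by (simp only: flux_rate_def distrib_left power2_eq_square) (simp add: mult_ac)
  qed
  finally show ?thesis .
qed

lemma flux_cont: "continuous_on {0..T} flux"
proof -
  have "continuous_on {0..T} (\<lambda>t. (\<Sum>i\<le>N. (1 + node i) * (poly (pderiv (phi t)) (node i) * v t i) * w i)
     - (real N + 1) / real N * ((real N / 2 * (\<Sum>i\<le>N. poly P (node i) * poly (phi t) (node i) * w i)) *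
        (real N / 2 * (\<Sum>i\<le>N. poly P (node i) * v t i * w i))))"
    by (intro continuous_intros phi_x_cont phi_node_cont v_cont) auto
  then show ?thesis
    by (rule continuous_on_eq) (auto simp: flux_def lc_phi lc_psi)
qed

lemma lc_bounds:
  assumes "t \<in> {0..T}"
  shows "real N * (lc (phi t))\<^sup>2 \<le> dsum (pderiv (phi t) * pderiv (phi t))"
    and "2 / real N * (lc (psi t))\<^sup>2 \<le> dsum (psi t * psi t)"
  using dsum_pderiv_square_ge[OF degree_phi[OF assms]] dsum_square_ge[OF degree_psi] by auto

text \<open>The constant is \<open>2 + 10 / 7\<close>: the multiplier satisfies
  \<open>0 <= 1 + x <= 2\<close>, and the correction is bounded by
  \<open>leading_coeff_cross_bound\<close>.\<close>

lemma flux_bound: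
  assumes t: "t \<in> {0..T}"
  shows "\<bar>flux t\<bar> \<le> 24 / 7 * energy t"
proof -
  let ?p = "\<lambda>i. poly (pderiv (phi t)) (node i)"
  have "\<bar>\<Sum>i\<le>N. (1 + node i) * (?p i * v t i) * w i\<bar> \<le> (\<Sum>i\<le>N. ((?p i)\<^sup>2 + (v t i)\<^sup>2) * w i)"
  proof (rule order.trans[OF sum_abs sum_mono])
    fix i assume "i \<in> {..N}"
    then have i: "0 \<le> 1 + node i" "1 + node i \<le> 2" "0 \<le> w i"
      using node_bounds[of i] weight_nonneg[of i] by auto
    have "0 \<le> (\<bar>?p i\<bar> - \<bar>v t i\<bar>)\<^sup>2" by simp
    then have "2 * \<bar>?p i * v t i\<bar> \<le> (?p i)\<^sup>2 + (v t i)\<^sup>2"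
      by (simp add: power2_diff abs_mult)
    moreover have "(1 + node i) * \<bar>?p i * v t i\<bar> \<le> 2 * \<bar>?p i * v t i\<bar>"
      using i by (intro mult_right_mono) auto
    ultimately have "(1 + node i) * \<bar>?p i * v t i\<bar> * w i \<le> ((?p i)\<^sup>2 + (v t i)\<^sup>2) * w i"
      using i by (intro mult_right_mono) auto
    then show "\<bar>(1 + node i) * (?p i * v t i) * w i\<bar> \<le> ((?p i)\<^sup>2 + (v t i)\<^sup>2) * w i"
      using i by (simp add: abs_mult)
  qed
  then have "\<bar>\<Sum>i\<le>N. (1 + node i) * (?p i * v t i) * w i\<bar> \<le> 2 * energy t"
    by (simp add: energy_sum)
  moreover have "\<bar>(real N + 1) / real N * (lc (phi t) * lc (psi t))\<bar> \<le> 10 / 7 * energy t"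
    unfolding energy_def using N_pos by (intro leading_coeff_cross_bound lc_bounds t) simp
  ultimately show ?thesis
    unfolding flux_def by (intro order.trans[OF abs_triangle_ineq4]) simp
qed

section \<open>The observed quantity and the integrated estimate\<close>

definition obs :: "real \<Rightarrow> real" where
  "obs t = (poly (pderiv (phi t)) 1 - om * poly (pderiv (pderiv (phi t))) 1)\<^sup>2
     + om * (poly (pderiv (pderiv (phi t))) 1)\<^sup>2 + om * (poly (pderiv (pderiv (phi t))) (-1))\<^sup>2"

lemma flux_rate_bound:
  assumes t: "t \<in> {0..T}"
  shows "flux_rate t \<le> 8 * obs t - 7 / 8 * energy t"
proof -
  have "0 \<le> 2 / real N * (lc (psi t))\<^sup>2" by simp
  then have "0 \<le> dsum (psi t * psi t)" using lc_bounds(2)[OF t] by linarith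
  then show ?thesis
    unfolding flux_rate_def obs_def energy_def
    using N_pos P_neg1 lc_bounds(1)[OF t] by (intro multiplier_flux_bound) auto
qed

lemma obs_cont: "continuous_on {0..T} obs"
  unfolding obs_def by (intro continuous_intros phi_x_cont phi_xx_cont)

lemma integral_obs:
  "integral {0..T} obs =
    integral {0..T} (\<lambda>t. (poly (pderiv (phi t)) 1 - om * poly (pderiv (pderiv (phi t))) 1)\<^sup>2)
    + om * integral {0..T} (\<lambda>t. (poly (pderiv (pderiv (phi t))) 1)\<^sup>2)
    + om * integral {0..T} (\<lambda>t. (poly (pderiv (pderiv (phi t))) (-1))\<^sup>2)"
proof -
  have "(obs has_integral
      integral {0..T} (\<lambda>t. (poly (pderiv (phi t)) 1 - om * poly (pderiv (pderiv (phi t))) 1)\<^sup>2)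
      + om * integral {0..T} (\<lambda>t. (poly (pderiv (pderiv (phi t))) 1)\<^sup>2)
      + om * integral {0..T} (\<lambda>t. (poly (pderiv (pderiv (phi t))) (-1))\<^sup>2)) {0..T}"
    unfolding obs_def[abs_def]
    by (intro has_integral_add has_integral_mult_right integrable_integral integrable_continuous_interval
          continuous_intros phi_x_cont phi_xx_cont)
  then show ?thesis by (rule integral_unique)
qed

text \<open>Integrate the flux rate over time. For \<open>T > 8\<close> the energy term is at least
  \<open>7 E\<close>, the two flux values cost at most \<open>48/7 E\<close>, and the remaining
  \<open>E / 7 <= 8 * integral {0..T} obs\<close> yields the factor \<open>56\<close>.\<close>

lemma observability:
  assumes "T > 8"
  shows "energy T \<le> 56 * integral {0..T} obs"
proof -
  let ?E = "energy 0"
  have "(flux_rate has_integral flux T - flux 0) {0..T}"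
    using T_pos flux_cont flux_deriv
    by (intro fundamental_theorem_of_calculus_interior)
       (auto simp flip: has_real_derivative_iff_has_vector_derivative)
  moreover have "((\<lambda>t. 8 * obs t - 7 / 8 * ?E) has_integral 8 * integral {0..T} obs - T * (7 / 8 * ?E)) {0..T}"
  proof (rule has_integral_diff)
    show "((\<lambda>t. 8 * obs t) has_integral 8 * integral {0..T} obs) {0..T}"
      by (intro has_integral_mult_right integrable_integral integrable_continuous_interval obs_cont)
    show "((\<lambda>t. 7 / 8 * ?E) has_integral T * (7 / 8 * ?E)) {0..T}"
      using has_integral_const_real[of "7 / 8 * ?E" 0 T] T_pos by simp
  qed
  ultimately have "flux T - flux 0 \<le> 8 * integral {0..T} obs - T * (7 / 8 * ?E)"
  proof (rule has_integral_le)
    show "flux_rate t \<le> 8 * obs t - 7 / 8 * ?E" if "t \<in> {0..T}" for t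
      using flux_rate_bound[OF that] energy_const[OF that] by simp
  qed
  moreover have "\<bar>flux T\<bar> \<le> 24 / 7 * ?E" "\<bar>flux 0\<bar> \<le> 24 / 7 * ?E"
    using flux_bound[of T] flux_bound[of 0] energy_const[of T] T_pos by auto
  \<comment> \<open>Nonnegativity of \<open>?E\<close> is read off from the flux bound.\<close>
  moreover have "8 * (7 / 8 * ?E) \<le> T * (7 / 8 * ?E)"
    using assms \<open>\<bar>flux 0\<bar> \<le> 24 / 7 * ?E\<close> by (intro mult_right_mono) auto
  ultimately have "?E \<le> 56 * integral {0..T} obs" by linarith
  then show ?thesis using energy_const[of T] T_pos by simp
qed

end

theorem lemma2:
  fixes T :: real
  assumes "T > 0"
  shows "\<exists>C :: real. C > 0 \<and>
    (\<forall>N :: nat. N \<ge> 1 \<longrightarrow> T > 4 * (2 + 1 / real N) \<longrightarrow>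
      (\<forall>phi0 \<in> poly_space_Di N. \<forall>phi1 \<in> poly_space_Di N. \<forall>phi :: real \<Rightarrow> real poly.
        collocation_solution T N phi0 phi1 phi \<longrightarrow>
        C * (discrete_pair_norm N (poly (pderiv phi0)) (poly phi1))\<^sup>2
        \<le> integral {0..T} (\<lambda>t. \<bar>poly (pderiv (phi t)) 1
               - lgl_weight N N * poly (pderiv (pderiv (phi t))) 1\<bar>\<^sup>2)
          + lgl_weight N N * integral {0..T} (\<lambda>t. \<bar>poly (pderiv (pderiv (phi t))) 1\<bar>\<^sup>2)
          + lgl_weight N 0 * integral {0..T} (\<lambda>t. \<bar>poly (pderiv (pderiv (phi t))) (-1)\<bar>\<^sup>2)))"
\<comment> \<open>\<open>112 = 2 * 56\<close>, since the squared pair norm of the data is twice the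
  energy at time \<open>T\<close>.\<close>
proof (intro exI[of _ "1 / 112"] conjI allI impI ballI)
  fix N :: nat and phi0 phi1 :: "real poly" and phi :: "real \<Rightarrow> real poly"
  assume N: "N \<ge> 1" and T: "T > 4 * (2 + 1 / real N)"
    and phi0: "phi0 \<in> poly_space_Di N" and phi1: "phi1 \<in> poly_space_Di N"
    and sol: "collocation_solution T N phi0 phi1 phi"
  have "8 < 4 * (2 + 1 / real N)" using N by simp
  with T have T8: "T > 8" by (rule order.strict_trans[rotated])
  interpret L: orthogonal_poly N "legendre N"
    using N by (intro orthogonal_poly_legendre) auto
  \<comment> \<open>Scaling to the value \<open>1\<close> at \<open>x = 1\<close> leaves the roots
    of the derivative, and hence the nodes, unchanged.\<close>
  define P where "P = smult (1 / poly (legendre N) 1) (legendre N)"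
  interpret orthogonal_poly N P
    unfolding P_def using L.poly_P_1_nz by (intro L.orthogonal_poly_smult) auto
  have "nodes = {x. (1 - x\<^sup>2) * poly (pderiv (legendre N)) x = 0}"
    unfolding nodes_def using L.poly_P_1_nz by (auto simp: P_def pderiv_smult)
  then have node: "node = lgl_node N"
    by (simp add: fun_eq_iff node_def lgl_node_def)
  \<comment> \<open>Existence of exact weights turns the choice in \<open>lgl_weight\<close> into
    the exactness property.\<close>
  have exact: "\<forall>p. degree p \<le> 2 * N - 1 \<longrightarrow> (\<Sum>i\<le>N. poly p (node i) * lgl_weight N i) = pint p"
    unfolding lgl_weight_def node[symmetric] pint_def
    by (rule someI_ex[OF exact_weights_exist[unfolded pint_def]])
  interpret gauss_lobatto N P "lgl_weight N"
    using exact L.poly_P_1_nz by unfold_locales (auto simp: P_def)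
  have norm: "(discrete_norm N (poly q))\<^sup>2 = dsum (q * q)" for q
  proof -
    have "discrete_inner N (poly q) (poly q) = dsum (q * q)"
      by (simp add: discrete_inner_def dsum_def node)
    then show ?thesis
      by (simp add: discrete_norm_def dsum_square_nonneg)
  qed
  from sol obtain phit phitt where
    space: "\<forall>t\<in>{0..T}. phi t \<in> poly_space_Di N" and
    deriv: "\<forall>x\<in>{-1..1}.
           (\<forall>t\<in>{0..T}. ((\<lambda>s. poly (phi s) x) has_real_derivative phit t x) (at t within {0..T})) \<and>
           continuous_on {0..T} (\<lambda>t. phit t x) \<and>
           (\<forall>t\<in>{0<..<T}. ((\<lambda>s. phit s x) has_real_derivative phitt t x) (at t))" and
    eqn: "\<forall>t\<in>{0<..<T}. \<forall>i\<in>{1..<N}.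
           phitt t (node i) - poly (pderiv (pderiv (phi t))) (node i) = 0" and
    final: "\<forall>i\<in>{1..<N}. poly (phi T) (node i) = poly phi0 (node i) \<and> phit T (node i) = poly phi1 (node i)"
    unfolding collocation_solution_def node[symmetric] by blast
  interpret collocation_wave N P "lgl_weight N" T phi "\<lambda>t i. phit t (node i)" "\<lambda>t i. phitt t (node i)"
  proof unfold_locales
    show "0 < T" by (rule assms)
    fix t assume "t \<in> {0..T}"
    with space show "degree (phi t) \<le> N" "poly (phi t) 1 = 0" "poly (phi t) (-1) = 0"
      by (auto simp: poly_space_Di_def poly_space_def)
  next
    fix i t assume "i \<le> N" "t \<in> {0..T}"
    then show "((\<lambda>s. poly (phi s) (node i)) has_real_derivative phit t (node i)) (at t within {0..T})"
      using deriv node_bounds by blast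
  next
    fix i assume "i \<le> N"
    then show "continuous_on {0..T} (\<lambda>t. phit t (node i))"
      using deriv node_bounds by blast
  next
    fix i t assume "i \<le> N" "t \<in> {0<..<T}"
    then show "((\<lambda>s. phit s (node i)) has_real_derivative phitt t (node i)) (at t)"
      using deriv node_bounds by blast
  next
    fix i t assume "i \<in> {1..<N}" "t \<in> {0<..<T}"
    then show "phitt t (node i) = poly (pderiv (pderiv (phi t))) (node i)"
      using eqn by simp
  qed
  have TT: "T \<in> {0..T}" using assms by simp
  have nodes_cases: "i = 0 \<or> i = N \<or> i \<in> {1..<N}" if "i \<le> N" for i
    using that by auto
  \<comment> \<open>Both have degree at most \<open>N\<close> and agree at all \<open>N + 1\<close>
    nodes: inside by the final condition, at the ends because both vanish.\<close>
  have "phi T = phi0"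
  proof (rule poly_eq_on_nodes[OF inj_node degree_phi[OF TT]])
    fix i assume "i \<le> N"
    from nodes_cases[OF this] show "poly (phi T) (node i) = poly phi0 (node i)"
      using final phi0 phi_boundary[OF TT] by (auto simp: poly_space_Di_def node_0 node_N)
  qed (use phi0 in \<open>auto simp: poly_space_Di_def poly_space_def\<close>)
  moreover have "psi T = phi1"
  proof (rule poly_eq_on_nodes[OF inj_node degree_psi])
    fix i assume i: "i \<le> N"
    from nodes_cases[OF this] show "poly (psi T) (node i) = poly phi1 (node i)"
      using final phi1 psi_boundary[OF TT] psi_node[OF i, of T]
      by (auto simp: poly_space_Di_def node_0 node_N)
  qed (use phi1 in \<open>auto simp: poly_space_Di_def poly_space_def\<close>)
  ultimately have "(discrete_pair_norm N (poly (pderiv phi0)) (poly phi1))\<^sup>2 = 2 * energy T"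
    by (simp add: discrete_pair_norm_def norm energy_def dsum_square_nonneg)
  then have "1 / 112 * (discrete_pair_norm N (poly (pderiv phi0)) (poly phi1))\<^sup>2 \<le> integral {0..T} obs"
    using observability[OF T8] by simp
  then show "1 / 112 * (discrete_pair_norm N (poly (pderiv phi0)) (poly phi1))\<^sup>2
        \<le> integral {0..T} (\<lambda>t. \<bar>poly (pderiv (phi t)) 1
               - lgl_weight N N * poly (pderiv (pderiv (phi t))) 1\<bar>\<^sup>2)
          + lgl_weight N N * integral {0..T} (\<lambda>t. \<bar>poly (pderiv (pderiv (phi t))) 1\<bar>\<^sup>2)
          + lgl_weight N 0 * integral {0..T} (\<lambda>t. \<bar>poly (pderiv (pderiv (phi t))) (-1)\<bar>\<^sup>2)"
    unfolding integral_obs weight_0 weight_N power2_abs .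
qed simp

end
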